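(* Let $T$ be an invertible measure preserving transformation on the Wiener space $(W,H,\mu)$. Then there exists a family $T_\theta$, $\theta\in[0,1]$, of measure preserving transformations of $W$ such that $T_0w=w$, $T_1=T$, and for every $\theta\in[0,1]$, $$E\,\bigl|T_\eta w-T_\theta w\bigr|_W\to0\quad\text{as }\eta\to\theta .$$
   Context: $(W,H,\mu)$ is an abstract Wiener space: $W$ is a separable Banach space with norm $|\cdot|_W$, $H$ (the Cameron-Martin space) is a separable Hilbert space densely and continuously embedded in $W$, $W^*\hookrightarrow H^*=H\hookrightarrow W$, and under the (Wiener) probability measure $\mu$ each $e\in W^*$ satisfies ${}_{W^*}(e,w)_W\sim N(0,|e|_H^2)$. $E$ is expectation with respect to $\mu$. A measure preserving transformation is a measurable map $T:W\to W$ with image measure $T^\star\mu=\mu$; maps, their equalities and invertibility are understood $\mu$-almost surely. *)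

theory Defs
  imports "HOL-Probability.Probability"
begin

text \<open>
  The law \<open>N(m, v)\<close> on the real line. The degenerate case \<open>v = 0\<close> (which occurs for the zero
  functional) has to be a point mass: \<^term>\<open>normal_density m 0\<close> is identically zero.
\<close>
definition gaussian_measure :: "real \<Rightarrow> real \<Rightarrow> real measure" where
  "gaussian_measure m v =
     (if v = 0 then return borel m else density lborel (\<lambda>x. ennreal (normal_density m (sqrt v) x)))"

text \<open>
  \<open>W\<close> and \<open>H\<close> are types, separability being second countability, and \<open>j\<close> is the embedding of \<open>H\<close>
  into \<open>W\<close>. The embedding of the dual of \<open>W\<close> into \<open>H\<close> (with \<open>H\<close> identified with its dual) sends
  \<open>e\<close> to the unique \<open>h\<close> with \<open>e (j k) = h \<bullet> k\<close> for all \<open>k\<close>, which exists by Riesz'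
  representation theorem; the norm of \<open>e\<close> in \<open>H\<close> is \<^term>\<open>norm h\<close>.
\<close>
locale abstract_wiener_space = prob_space \<mu>
  for j :: "'h::{real_inner, banach, second_countable_topology} \<Rightarrow>
            'w::{banach, second_countable_topology}"
  and \<mu> :: "'w measure" +
  assumes sets_borel: "sets \<mu> = sets borel"
    and embedding_bounded_linear: "bounded_linear j"
    and embedding_inj: "inj j"
    and embedding_dense: "closure (range j) = UNIV"
    and dual_gaussian:
      "\<And>e :: 'w \<Rightarrow>\<^sub>L real.
         \<exists>h. (\<forall>k. blinfun_apply e (j k) = h \<bullet> k) \<and>
             distr \<mu> borel (blinfun_apply e) = gaussian_measure 0 ((norm h)\<^sup>2)"

definition measure_preserving :: "'a measure \<Rightarrow> ('a \<Rightarrow> 'a) \<Rightarrow> bool" where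
  "measure_preserving M T \<longleftrightarrow> T \<in> M \<rightarrow>\<^sub>M M \<and> distr M M T = M"

definition ae_invertible :: "'a measure \<Rightarrow> ('a \<Rightarrow> 'a) \<Rightarrow> bool" where
  "ae_invertible M T \<longleftrightarrow>
     (\<exists>S. S \<in> M \<rightarrow>\<^sub>M M \<and> (AE w in M. S (T w) = w) \<and> (AE w in M. T (S w) = w))"

end

theory Submission
  imports Defs
begin

text \<open>
  Let \<open>A\<^sub>\<theta>\<close> be the sublevel sets of a functional with a continuous law, with \<open>A\<^sub>0 = \<emptyset>\<close> and \<open>A\<^sub>1 = W\<close>, and
  let \<open>T\<^sub>\<theta>\<close> be the first-return map of \<open>T\<close> to \<open>A\<^sub>\<theta>\<close>, extended by the identity (Keane's contraction of the
  automorphism group). It preserves \<open>\<mu>\<close>, and if \<open>A \<subseteq> B\<close> the return maps to \<open>A\<close> and \<open>B\<close> differ only at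
  points which lie in, or are sent by the latter into, \<open>B - A\<close>. Hence \<open>\<mu> {T\<^sub>\<eta> \<noteq> T\<^sub>\<theta>} \<rightarrow> 0\<close>, and as all
  \<open>T\<^sub>\<eta>\<close> have law \<open>\<mu>\<close>, integrability of the norm upgrades this to convergence in mean. Integrability is
  Fernique's theorem: \<open>\<mu> \<otimes> \<mu>\<close> is invariant under rotation by \<open>\<pi>/4\<close>, because a Borel measure on a
  separable space is determined by the characteristic functions of functionals, by Hahn-Banach.
\<close>

section \<open>Norming functionals\<close>

definition sublinear :: "('a::real_vector \<Rightarrow> real) \<Rightarrow> bool" where
  "sublinear q \<longleftrightarrow> (\<forall>x y. q (x + y) \<le> q x + q y) \<and> (\<forall>c x. 0 \<le> c \<longrightarrow> q (c *\<^sub>R x) = c * q x)"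

text \<open>A minimal sublinear functional agrees with all its tilts, which forces it to be additive.\<close>
definition sublinear_tilt :: "('a::real_vector \<Rightarrow> real) \<Rightarrow> 'a \<Rightarrow> 'a \<Rightarrow> real" where
  "sublinear_tilt q y x = (INF t\<in>{0..}. q (x + t *\<^sub>R y) - t * q y)"

lemma sublinear_minus_le:
  assumes "sublinear q" shows "- q (- x) \<le> q x"
proof -
  have "q (0 *\<^sub>R x) = 0 * q x" using assms unfolding sublinear_def by blast
  moreover have "q (x + - x) \<le> q x + q (- x)" using assms unfolding sublinear_def by blast
  ultimately show ?thesis by simp
qed

lemma
  assumes q: "sublinear q"
  shows bdd_below_tilt: "bdd_below ((\<lambda>t. q (x + t *\<^sub>R y) - t * q y) ` {0..})"
    and sublinear_tilt_le: "0 \<le> t \<Longrightarrow> sublinear_tilt q y x \<le> q (x + t *\<^sub>R y) - t * q y"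
proof -
  have sub: "q (a + b) \<le> q a + q b" for a b using q unfolding sublinear_def by blast
  have hom: "0 \<le> c \<Longrightarrow> q (c *\<^sub>R a) = c * q a" for c a using q unfolding sublinear_def by blast
  have "- q (- x) \<le> q (x + t *\<^sub>R y) - t * q y" if "0 \<le> t" for t
    using sub[of "x + t *\<^sub>R y" "- x"] hom[OF that, of y] by simp
  then show bdd: "bdd_below ((\<lambda>t. q (x + t *\<^sub>R y) - t * q y) ` {0..})"
    by (intro bdd_belowI2[where m = "- q (- x)"]) auto
  show "0 \<le> t \<Longrightarrow> sublinear_tilt q y x \<le> q (x + t *\<^sub>R y) - t * q y"
    unfolding sublinear_tilt_def by (rule cINF_lower[OF bdd]) auto
qed

text \<open>Parameters \<open>s\<close> for \<open>a\<close> and \<open>t\<close> for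
  \<open>b\<close> combine to the admissible parameter \<open>s + t\<close> for
  \<open>a + b\<close>, so subadditivity survives the two infima, taken one after the other.
  Homogeneity comes from rescaling the parameter to \<open>c * t\<close>.\<close>

lemma sublinear_sublinear_tilt:
  assumes q: "sublinear q" shows "sublinear (sublinear_tilt q y)"
proof -
  let ?r = "sublinear_tilt q y"
  have sub: "q (a + b) \<le> q a + q b" for a b using q unfolding sublinear_def by blast
  have hom: "0 \<le> c \<Longrightarrow> q (c *\<^sub>R a) = c * q a" for c a using q unfolding sublinear_def by blast
  have add: "?r (a + b) \<le> ?r a + ?r b" for a b
  proof -
    have *: "?r (a + b) \<le> (q (a + s *\<^sub>R y) - s * q y) + (q (b + t *\<^sub>R y) - t * q y)"
      if "0 \<le> s" "0 \<le> t" for s t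
      using sublinear_tilt_le[OF q, of "s + t" y "a + b"] sub[of "a + s *\<^sub>R y" "b + t *\<^sub>R y"] that
      by (simp add: algebra_simps)
    have "?r (a + b) - (q (a + s *\<^sub>R y) - s * q y) \<le> ?r b" if "0 \<le> s" for s
      unfolding sublinear_tilt_def[of q y b] using *[OF that]
      by (intro cINF_greatest) (auto simp: algebra_simps)
    then have "?r (a + b) - ?r b \<le> ?r a"
      unfolding sublinear_tilt_def[of q y a]
      by (intro cINF_greatest) (auto simp: algebra_simps)
    then show ?thesis by simp
  qed
  \<comment> \<open>One inequality for all positive factors is enough: applied to
    \<open>1 / c\<close> and the vector \<open>c *\<^sub>R a\<close> it becomes the reverse
    one.\<close>
  have le: "?r (c *\<^sub>R a) \<le> c * ?r a" if "0 < c" for c a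
  proof -
    have "?r (c *\<^sub>R a) / c \<le> q (a + t *\<^sub>R y) - t * q y" if "0 \<le> t" for t
      using sublinear_tilt_le[OF q, of "c * t" y "c *\<^sub>R a"] \<open>0 < c\<close> that
        hom[of c "a + t *\<^sub>R y"]
      by (simp add: field_simps scaleR_add_right)
    then have "?r (c *\<^sub>R a) / c \<le> ?r a"
      unfolding sublinear_tilt_def[of q y a] by (intro cINF_greatest) auto
    then show ?thesis using \<open>0 < c\<close> by (simp add: field_simps)
  qed
  have "?r (c *\<^sub>R a) = c * ?r a" if "0 < c" for c a
    using le[OF that, of a] le[of "1 / c" "c *\<^sub>R a"] that by (simp add: field_simps)
  moreover have "?r 0 = 0"
    unfolding sublinear_tilt_def using hom[of _ y] hom[of 0 0] by (simp cong: INF_cong_simp)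
  ultimately show ?thesis
    unfolding sublinear_def using add by (metis mult_zero_left order_le_less scaleR_zero_left)
qed

lemma minimal_sublinear_linear:
  assumes q: "sublinear q" and min: "\<And>r. sublinear r \<Longrightarrow> r \<le> q \<Longrightarrow> r = q"
  shows "linear q"
proof -
  have hom: "0 \<le> c \<Longrightarrow> q (c *\<^sub>R a) = c * q a" for c a using q unfolding sublinear_def by blast
  have tilt: "sublinear_tilt q y = q" for y
    using sublinear_tilt_le[OF q, of 0]
    by (intro min sublinear_sublinear_tilt q le_funI) auto
  have add: "q (x + y) = q x + q y" for x y
  proof (rule antisym)
    show "q (x + y) \<le> q x + q y" using q unfolding sublinear_def by blast
    \<comment> \<open>The tilt is \<open>q\<close> itself, and its value at \<open>x\<close> is at
      most the term for \<open>t = 1\<close>, namely \<open>q (x + y) - q y\<close>.\<close>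
    show "q x + q y \<le> q (x + y)"
      using sublinear_tilt_le[OF q, of 1 y x] by (simp add: tilt)
  qed
  have neg: "q (- x) = - q x" for x using add[of x "- x"] hom[of 0 x] by simp
  show ?thesis
  proof (rule linearI)
    show "q (x + y) = q x + q y" for x y by (rule add)
    show "q (c *\<^sub>R x) = c *\<^sub>R q x" for c x
      using hom[of c x] hom[of "- c" x] neg[of "c *\<^sub>R x"] by (cases "0 \<le> c") auto
  qed
qed

text \<open>Zorn's lemma for the reversed pointwise order, with the pointwise infimum as lower bound
  of a chain. The infimum is finite because any sublinear \<open>a \<le> p\<close> satisfies
  \<open>a x \<ge> - a (- x) \<ge> - p (- x)\<close>.\<close>

lemma minimal_sublinear_exists:
  assumes p: "sublinear p"
  obtains q where "sublinear q" "q \<le> p" "\<And>r. sublinear r \<Longrightarrow> r \<le> q \<Longrightarrow> r = q"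
proof -
  let ?S = "{q. sublinear q \<and> q \<le> p}"
  have "\<exists>m\<in>?S. \<forall>a\<in>?S. m \<ge> a \<longrightarrow> a = m"
  proof (rule predicate_Zorn[where P = "\<lambda>a b. a \<ge> b"])
    show "partial_order_on ?S (relation_of (\<lambda>a b. a \<ge> b) ?S)"
      by (rule partial_order_on_relation_ofI) auto
    fix C assume "C \<in> Chains (relation_of (\<lambda>a b. b \<le> a) ?S)"
    then have C: "C \<subseteq> ?S" and chain: "\<And>a b. a \<in> C \<Longrightarrow> b \<in> C \<Longrightarrow> a \<le> b \<or> b \<le> a"
      unfolding Chains_def relation_of_def by auto
    show "\<exists>u\<in>?S. \<forall>a\<in>C. u \<le> a"
    proof (cases "C = {}")
      case True then show ?thesis using p by auto
    next
      case False
      define u where "u = (\<lambda>x. INF a\<in>C. a x)"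
      have "- p (- x) \<le> a x" if "a \<in> C" for a x
        using C that sublinear_minus_le[of a x] by (force simp: le_fun_def dest: spec[of _ "- x"])
      then have bdd: "bdd_below ((\<lambda>a. a x) ` C)" for x
        by (intro bdd_belowI2[where m = "- p (- x)"])
      have le: "u x \<le> a x" if "a \<in> C" for a x
        unfolding u_def by (rule cINF_lower[OF bdd that])
      have sub: "a (x + y) \<le> a x + a y" if "a \<in> C" for a x y
        using C that unfolding sublinear_def by blast
      have hom: "0 \<le> c \<Longrightarrow> a (c *\<^sub>R x) = c * a x" if "a \<in> C" for a c x
        using C that unfolding sublinear_def by blast
      have add: "u (x + y) \<le> u x + u y" for x y
      proof -
        \<comment> \<open>Here the chain property enters: the smaller of \<open>a\<close> and
          \<open>b\<close> is subadditive and lies below both, so evaluating it at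
          \<open>x + y\<close> bounds the infimum.\<close>
        have *: "u (x + y) \<le> a x + b y" if "a \<in> C" "b \<in> C" for a b
          using chain[OF that] le[OF that(1), of "x + y"] le[OF that(2), of "x + y"]
            sub[OF that(1), of x y] sub[OF that(2), of x y]
          by (auto simp: le_fun_def) (smt (verit))+
        have "u (x + y) - a x \<le> u y" if "a \<in> C" for a
          unfolding u_def[THEN fun_cong, of y] using *[OF that] False
          by (intro cINF_greatest) (auto simp: algebra_simps)
        then have "u (x + y) - u y \<le> u x"
          unfolding u_def[THEN fun_cong, of x] using False
          by (intro cINF_greatest) (auto simp: algebra_simps)
        then show ?thesis by simp
      qed
      have ule: "u (c *\<^sub>R x) \<le> c * u x" if "0 < c" for c x
      proof -
        have "u (c *\<^sub>R x) / c \<le> u x"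
          unfolding u_def[THEN fun_cong, of x]
          using le[of _ "c *\<^sub>R x"] hom that False
          by (intro cINF_greatest) (fastforce simp: field_simps)+
        then show ?thesis using that by (simp add: field_simps)
      qed
      have "u (c *\<^sub>R x) = c * u x" if "0 < c" for c x
        using ule[OF that, of x] ule[of "1 / c" "c *\<^sub>R x"] that by (simp add: field_simps)
      moreover have "(\<lambda>a. a 0) ` C = {0}" using hom[of _ 0 0] False by (force simp: image_iff)
      then have "u 0 = 0" unfolding u_def by simp
      ultimately have "sublinear u"
        unfolding sublinear_def using add
        by (metis mult_zero_left order_le_less scaleR_zero_left)
      moreover have "u \<le> p"
      proof (rule le_funI)
        fix x
        obtain a where a: "a \<in> C" using False by blast
        then have "a \<le> p" using C by blast
        then show "u x \<le> p x" using le[OF a, of x] le_funD[of a p x] by simp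
      qed
      moreover have "\<forall>a\<in>C. u \<le> a" using le by (simp add: le_fun_def)
      ultimately show ?thesis by blast
    qed
  qed
  then obtain m where "sublinear m" "m \<le> p"
    and "\<And>r. sublinear r \<Longrightarrow> r \<le> p \<Longrightarrow> r \<le> m \<Longrightarrow> r = m"
    by blast
  then show ?thesis by (intro that[of m]) (auto intro: order_trans)
qed

text \<open>The minimal functional is sought below the tilt of the norm in direction
  \<open>x\<close> rather than below the norm. At \<open>- x\<close> the tilt is at most
  \<open>norm 0 - norm x\<close>, so linearity forces the value at \<open>x\<close> up to
  \<open>norm x\<close>.\<close>

lemma norming_functional_exists:
  fixes x :: "'a::real_normed_vector"
  obtains f :: "'a \<Rightarrow>\<^sub>L real" where "\<And>y. f y \<le> norm y" "f x = norm x"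
proof -
  have n: "sublinear (norm :: 'a \<Rightarrow> real)"
    unfolding sublinear_def by (auto simp: norm_triangle_ineq)
  obtain q where q: "sublinear q" "q \<le> sublinear_tilt norm x"
    "\<And>r. sublinear r \<Longrightarrow> r \<le> q \<Longrightarrow> r = q"
    using minimal_sublinear_exists[OF sublinear_sublinear_tilt[OF n]] by blast
  have lin: "linear q" by (rule minimal_sublinear_linear[OF q(1,3)])
  have le: "q y \<le> norm y" for y
    using le_funD[OF q(2), of y] sublinear_tilt_le[OF n, of 0 x y] by simp
  have "q (- x) \<le> - norm x"
    using le_funD[OF q(2), of "- x"] sublinear_tilt_le[OF n, of 1 x "- x"] by simp
  then have x: "q x = norm x" using linear_neg[OF lin, of x] le[of x] by simp
  have "\<bar>q y\<bar> \<le> norm y" for y using le[of y] le[of "- y"] linear_neg[OF lin, of y] by auto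
  then have bl: "bounded_linear q"
    by (intro bounded_linear_intro[where K = 1]) (auto simp: linear_add[OF lin] linear_scale[OF lin])
  show ?thesis
    by (rule that[of "Blinfun q"]) (auto simp: bounded_linear_Blinfun_apply[OF bl] le x)
qed

section \<open>Measures determined by functionals\<close>

text \<open>Functionals norming the points of a countable dense set cut out every closed ball as a
  countable intersection of half-spaces, and in a separable space every open set is a countable
  union of closed balls.\<close>

lemma sets_borel_eq_sigma_functionals:
  "sets (borel :: 'a::{real_normed_vector, second_countable_topology} measure) =
    sigma_sets UNIV {blinfun_apply f -` A | (f :: 'a \<Rightarrow>\<^sub>L real) A. A \<in> sets borel}"
    (is "_ = sigma_sets UNIV ?G")
proof
  show "sigma_sets UNIV ?G \<subseteq> sets borel"
  proof -
    have "blinfun_apply f -` A \<in> sets borel" if "A \<in> sets borel" for f :: "'a \<Rightarrow>\<^sub>L real" and A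
      using measurable_sets[OF borel_measurable_continuous_onI that, of f]
      by (simp add: linear_continuous_on blinfun.bounded_linear_right)
    then have "?G \<subseteq> sets borel" by blast
    then show ?thesis using sets.sigma_sets_subset[of ?G borel] by simp
  qed
  interpret S: sigma_algebra UNIV "sigma_sets UNIV ?G" by (rule sigma_algebra_sigma_sets) auto
  obtain D :: "'a set" where D: "countable D" "\<And>X. open X \<Longrightarrow> X \<noteq> {} \<Longrightarrow> \<exists>d\<in>D. d \<in> X"
    using countable_dense_setE by blast
  obtain F :: "'a \<Rightarrow> 'a \<Rightarrow>\<^sub>L real" where F: "\<And>x y. F x y \<le> norm y" "\<And>x. F x x = norm x"
    using norming_functional_exists by metis
  have cball: "cball x r \<in> sigma_sets UNIV ?G" for x r
  proof -
    \<comment> \<open>The vector \<open>y - x\<close> need not lie in \<open>D\<close>, so a nearby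
      \<open>d\<close> is tested instead. Replacing \<open>y - x\<close> by \<open>d\<close> costs
      \<open>e / 2\<close> in the norm and another \<open>e / 2\<close> in the functional.\<close>
    have "norm (y - x) \<le> r" if *: "\<And>d. d \<in> D \<Longrightarrow> F d y \<le> F d x + r" for y
    proof (rule field_le_epsilon)
      fix e :: real assume "0 < e"
      then obtain d where "d \<in> D" and d: "d \<in> ball (y - x) (e / 2)"
        using D(2)[of "ball (y - x) (e / 2)"] by auto
      have "norm (y - x) \<le> norm d + norm (y - x - d)"
        using norm_triangle_ineq[of d "y - x - d"] by simp
      moreover have "norm d = F d (y - x) - F d (y - x - d)"
        by (simp add: F(2) blinfun.diff_right)
      moreover have "F d (y - x) \<le> r"
        using *[OF \<open>d \<in> D\<close>] by (simp add: blinfun.diff_right)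
      moreover have "- F d (y - x - d) \<le> norm (y - x - d)"
        using F(1)[of d "- (y - x - d)"] by (simp only: blinfun.minus_right norm_minus_cancel)
      ultimately show "norm (y - x) \<le> r + e" using d by (simp add: dist_norm)
    qed
    moreover have "F d y \<le> F d x + r" if "norm (y - x) \<le> r" for d y
      using F(1)[of d "y - x"] that by (simp add: blinfun.diff_right)
    ultimately have eq: "cball x r = (\<Inter>d\<in>D. blinfun_apply (F d) -` {..F d x + r})"
      by (auto simp: dist_norm norm_minus_commute)
    have "D \<noteq> {}" using D(2)[of UNIV] by blast
    moreover have "blinfun_apply (F d) -` {..F d x + r} \<in> sigma_sets UNIV ?G" for d
      by (rule sigma_sets.Basic) (use atMost_borel in blast)
    ultimately show ?thesis
      unfolding eq by (intro S.countable_INT' D(1) image_subsetI)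
  qed
  have "open U \<Longrightarrow> U \<in> sigma_sets UNIV ?G" for U :: "'a set"
  proof -
    assume U: "open U"
    define I where "I = {(d, n :: nat). d \<in> D \<and> cball d (1 / Suc n) \<subseteq> U}"
    have "countable I"
      by (rule countable_subset[of _ "D \<times> UNIV"]) (auto simp: I_def D(1))
    moreover have "U = (\<Union>(d, n)\<in>I. cball d (1 / Suc n))"
    proof
      show "U \<subseteq> (\<Union>(d, n)\<in>I. cball d (1 / Suc n))"
      proof
        fix x assume "x \<in> U"
        then obtain e where e: "0 < e" "ball x e \<subseteq> U" using U openE by blast
        obtain n :: nat where n: "1 / Suc n < e / 2"
          using nat_approx_posE[of "e / 2"] e(1) by auto
        obtain d where d: "d \<in> D" "d \<in> ball x (1 / Suc n)"
          using D(2)[of "ball x (1 / Suc n)"] by auto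
        have "cball d (1 / Suc n) \<subseteq> ball x e"
        proof
          fix y assume "y \<in> cball d (1 / Suc n)"
          then show "y \<in> ball x e"
            using d(2) n dist_triangle[of x y d] by (simp del: of_nat_Suc)
        qed
        then have "(d, n) \<in> I" using d(1) e(2) unfolding I_def by blast
        moreover have "x \<in> cball d (1 / Suc n)"
          using d(2) by (simp add: dist_commute del: of_nat_Suc)
        ultimately show "x \<in> (\<Union>(d, n)\<in>I. cball d (1 / Suc n))" by blast
      qed
    qed (auto simp: I_def)
    moreover have "(\<Union>(d, n)\<in>I. cball d (1 / Suc n)) \<in> sigma_sets UNIV ?G"
      using \<open>countable I\<close> by (rule S.countable_UN') (auto simp only: cball)
    ultimately show ?thesis by (simp only:)
  qed
  then have "sigma_sets UNIV {S :: 'a set. open S} \<subseteq> sigma_sets UNIV ?G"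
    by (intro S.sigma_sets_subset) blast
  moreover have "sets (borel :: 'a measure) = sigma_sets UNIV {S. open S}"
    by (simp add: borel_def)
  ultimately show "sets (borel :: 'a measure) \<subseteq> sigma_sets UNIV ?G" by (simp only:)
qed

section \<open>Uniqueness on the line and its iteration over cylinder sets\<close>

lemma borel_measurable_blinfun_apply[measurable]:
  fixes f :: "'a::real_normed_vector \<Rightarrow>\<^sub>L real"
  shows "blinfun_apply f \<in> borel_measurable borel"
  by (intro borel_measurable_continuous_onI linear_continuous_on blinfun.bounded_linear_right)

text \<open>With \<open>v\<close> as a probability density, the laws of \<open>g\<close> under the
  two weighted measures have the same characteristic function, and Levy's uniqueness theorem
  identifies them.\<close>

lemma weighted_integral_indicator_eqI:
  fixes g v :: "'a \<Rightarrow> real"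
  assumes sets: "sets M = sets N"
    and g: "g \<in> borel_measurable M" and v: "v \<in> borel_measurable M" "\<And>x. 0 \<le> v x"
    and one: "integral\<^sup>L M v = 1" "integral\<^sup>L N v = 1"
    and cos: "\<And>t c. (\<integral>x. v x * cos (t * g x + c) \<partial>M) = (\<integral>x. v x * cos (t * g x + c) \<partial>N)"
    and A: "A \<in> sets borel"
  shows "(\<integral>x. v x * indicator A (g x) \<partial>M) = (\<integral>x. v x * indicator A (g x) \<partial>N)"
proof -
  define P where "P K = distr (density K (\<lambda>x. ennreal (v x))) borel g" for K
  have P: "real_distribution (P K)"
    \<comment> \<open>The phase \<open>0\<close> yields the real part; the phase
      \<open>- pi / 2\<close> turns the cosine into a sine and yields the imaginary part.\<close>
    "char (P K) t = Complex (\<integral>x. v x * cos (t * g x + 0) \<partial>K) (\<integral>x. v x * cos (t * g x + - pi / 2) \<partial>K)"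
    "measure (P K) A = (\<integral>x. v x * indicator A (g x) \<partial>K)"
    if gK[measurable]: "g \<in> borel_measurable K" and vK[measurable]: "v \<in> borel_measurable K"
      and oneK: "integral\<^sup>L K v = 1" for K t
  proof -
    note [measurable] = A
    have int: "integrable K v" using oneK not_integrable_integral_eq by fastforce
    have "(\<integral>\<^sup>+x. ennreal (v x) \<partial>K) = 1"
      using nn_integral_eq_integral[OF int] v(2) oneK by simp
    then interpret D: prob_space "density K (\<lambda>x. ennreal (v x))"
      by (intro prob_spaceI) (simp add: emeasure_density cong: nn_integral_cong)
    have gD: "g \<in> borel_measurable (density K (\<lambda>x. ennreal (v x)))" by simp
    show "real_distribution (P K)"
      unfolding P_def by (rule D.real_distribution_distr[OF gD])
    have bound: "norm (v x *\<^sub>R iexp (t * g x)) \<le> norm (v x)" for x by simp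
    have "integrable K (\<lambda>x. v x *\<^sub>R iexp (t * g x))"
      by (rule Bochner_Integration.integrable_bound[OF int]) (auto simp: bound)
    moreover have "char (P K) t = (CLINT x|K. v x *\<^sub>R iexp (t * g x))"
      unfolding char_def P_def using v(2)
      by (subst integral_distr[OF gD], simp, subst integral_density) auto
    ultimately show "char (P K) t = Complex (\<integral>x. v x * cos (t * g x + 0) \<partial>K)
      (\<integral>x. v x * cos (t * g x + - pi / 2) \<partial>K)"
      by (intro complex_eqI) (simp_all add: integral_Re[symmetric] integral_Im[symmetric] cos_diff
        Re_exp Im_exp del: integral_Re integral_Im)
    have "measure (P K) A = (\<integral>x. indicator A x \<partial>P K)"
      by (simp add: P_def)
    also have "\<dots> = (\<integral>x. v x * indicator A (g x) \<partial>K)"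
      unfolding P_def using v(2)
      by (subst integral_distr[OF gD], simp, subst integral_density) auto
    finally show "measure (P K) A = (\<integral>x. v x * indicator A (g x) \<partial>K)" .
  qed
  have gN: "g \<in> borel_measurable N" and vN: "v \<in> borel_measurable N"
    using g v(1) sets by (simp_all cong: measurable_cong_sets)
  have "char (P M) = char (P N)"
    by (intro ext) (simp only: P(2)[OF g v(1) one(1)] P(2)[OF gN vN one(2)] cos)
  then have "P M = P N"
    by (rule Levy_uniqueness[OF P(1)[OF g v(1) one(1)] P(1)[OF gN vN one(2)]])
  then show ?thesis
    using P(3)[OF g v(1) one(1)] P(3)[OF gN vN one(2)] by simp
qed

lemma integrable_indicator_cos:
  fixes f :: "'a::real_normed_vector \<Rightarrow>\<^sub>L real"
  assumes "prob_space M" "sets M = sets borel" "B \<in> sets borel"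
  shows "integrable M (\<lambda>x. indicator B x * cos (f x + c))"
proof -
  interpret prob_space M by fact
  have [measurable_cong]: "sets M = sets borel" and [measurable]: "B \<in> sets borel" by fact+
  show ?thesis
    by (rule integrable_const_bound[where B = 1]) (auto simp: abs_mult indicator_def)
qed

text \<open>Adding \<open>2\<close> turns the signed density \<open>1\<^sub>B cos (f + c)\<close> into a positive one, to which the
  one-dimensional uniqueness theorem applies.\<close>
lemma indicator_cos_integral_step:
  fixes M N :: "'a::real_normed_vector measure" and f g :: "'a \<Rightarrow>\<^sub>L real"
  assumes M: "prob_space M" "sets M = sets borel" and N: "prob_space N" "sets N = sets borel"
    and cos: "\<And>(f :: 'a \<Rightarrow>\<^sub>L real) c. (\<integral>x. cos (f x + c) \<partial>M) = (\<integral>x. cos (f x + c) \<partial>N)"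
    and B: "B \<in> sets borel"
    and B_cos: "\<And>(f :: 'a \<Rightarrow>\<^sub>L real) c.
      (\<integral>x. indicator B x * cos (f x + c) \<partial>M) = (\<integral>x. indicator B x * cos (f x + c) \<partial>N)"
    and A: "A \<in> sets borel"
  shows "(\<integral>x. indicator (B \<inter> blinfun_apply g -` A) x * cos (f x + c) \<partial>M) =
    (\<integral>x. indicator (B \<inter> blinfun_apply g -` A) x * cos (f x + c) \<partial>N)"
proof -
  interpret M: prob_space M by fact
  interpret N: prob_space N by fact
  note [measurable_cong] = M(2) N(2)
  note [measurable] = B A
  note int = integrable_indicator_cos[OF M B] integrable_indicator_cos[OF N B]
    integrable_indicator_cos[OF M, of UNIV, simplified] integrable_indicator_cos[OF N, of UNIV, simplified]
  let ?u = "\<lambda>x. indicator B x * cos (f x + c) :: real"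
  \<comment> \<open>The common total mass of \<open>2 + ?u\<close> under \<open>M\<close> and
    \<open>N\<close>. It is at least \<open>1\<close> because \<open>?u \<ge> - 1\<close>, so
    division by it is safe.\<close>
  define m where "m = 2 + integral\<^sup>L M ?u"
  have bound: "\<bar>?u x\<bar> \<le> 1" for x by (auto simp: indicator_def)
  have "- 1 \<le> integral\<^sup>L M ?u"
    using integral_mono[OF _ int(1)[of f c], of "\<lambda>_. - 1"] bound
    by (simp add: abs_le_iff) (metis M.prob_space minus_le_iff)
  then have "m > 0" unfolding m_def by simp
  have mN: "m = 2 + integral\<^sup>L N ?u" unfolding m_def by (simp add: B_cos)
  define v where "v x = (2 + ?u x) / m" for x
  have v: "0 \<le> v x" for x
    using bound[of x] \<open>m > 0\<close> unfolding v_def by (auto simp: abs_le_iff)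
  have vm[measurable]: "v \<in> borel_measurable borel" unfolding v_def by measurable
  have one: "integral\<^sup>L M v = 1" "integral\<^sup>L N v = 1"
    unfolding v_def using int(1,2)[of f c] \<open>m > 0\<close> m_def mN
    by (simp_all add: M.prob_space N.prob_space)
  have v_cos: "(\<integral>x. v x * cos (t * g x + d) \<partial>M) = (\<integral>x. v x * cos (t * g x + d) \<partial>N)" for t d
  proof -
    \<comment> \<open>The product formula for cosines brings everything back to single cosines of
      the functionals \<open>f + t *\<^sub>R g\<close> and \<open>f - t *\<^sub>R g\<close>, which
      \<open>cos\<close> and \<open>B_cos\<close> cover.\<close>
    have eq: "v x * cos (t * g x + d) = (2 / m) * cos ((t *\<^sub>R g) x + d)
      + (1 / (2 * m)) * (indicator B x * cos ((f + t *\<^sub>R g) x + (c + d)))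
      + (1 / (2 * m)) * (indicator B x * cos ((f - t *\<^sub>R g) x + (c - d)))" for x
    proof -
      have "cos (f x + c) * cos (t * g x + d)
          = (cos (f x + c - (t * g x + d)) + cos (f x + c + (t * g x + d))) / 2"
        by (rule cos_times_cos)
      moreover have "v x * cos (t * g x + d) = (2 / m) * cos (t * g x + d)
          + (1 / m) * indicator B x * (cos (f x + c) * cos (t * g x + d))"
        using \<open>m > 0\<close> unfolding v_def by (simp add: field_simps)
      ultimately have "v x * cos (t * g x + d) = (2 / m) * cos (t * g x + d)
          + (1 / m) * indicator B x
            * ((cos (f x + c - (t * g x + d)) + cos (f x + c + (t * g x + d))) / 2)"
        by (simp only:)
      then show ?thesis
        by (simp add: blinfun.bilinear_simps algebra_simps add_divide_distrib)
    qed
    show ?thesis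
      unfolding eq using int by (simp add: B_cos cos)
  qed
  have one_cos: "(\<integral>x. 1 * cos (t * g x + d) \<partial>M) = (\<integral>x. 1 * cos (t * g x + d) \<partial>N)" for t d
    using cos[of "t *\<^sub>R g" d] by (simp add: blinfun.bilinear_simps)
  have v_A: "(\<integral>x. v x * indicator A (g x) \<partial>M) = (\<integral>x. v x * indicator A (g x) \<partial>N)"
    by (rule weighted_integral_indicator_eqI) (use v one v_cos A M(2) N(2) in auto)
  have one_A: "(\<integral>x. 1 * indicator A (g x) \<partial>M) = (\<integral>x. 1 * indicator A (g x) \<partial>N :: real)"
    by (rule weighted_integral_indicator_eqI)
      (use one_cos A M(2) N(2) in \<open>auto simp: M.prob_space N.prob_space\<close>)
  have eq: "indicator (B \<inter> blinfun_apply g -` A) x * cos (f x + c)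
      = m * (v x * indicator A (g x)) - 2 * (1 * indicator A (g x))" for x
    using \<open>m > 0\<close> unfolding v_def by (simp add: indicator_def)
  have "integrable K (\<lambda>x. v x * indicator A (g x))" "integrable K (\<lambda>x. 1 * indicator A (g x) :: real)"
    if "prob_space K" and [measurable_cong]: "sets K = sets borel" for K
  proof -
    interpret prob_space K by fact
    have "v x \<le> 3 / m" for x
      using bound[of x] \<open>m > 0\<close> unfolding v_def by (simp add: divide_right_mono abs_le_iff)
    then show "integrable K (\<lambda>x. v x * indicator A (g x))"
      using v \<open>m > 0\<close> by (intro integrable_const_bound[where B = "3 / m"]) (auto simp: indicator_def)
    show "integrable K (\<lambda>x. 1 * indicator A (g x) :: real)"
      by (intro integrable_const_bound[where B = 1]) (auto simp: indicator_def)
  qed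
  from this[OF M] this[OF N] show ?thesis
    unfolding eq by (simp add: v_A one_A[simplified])
qed

text \<open>Finite intersections of preimages under functionals form an intersection-stable
  generator of the Borel sets. Agreement on them is obtained by adding one functional at a
  time.\<close>

lemma measure_eqI_functionals:
  fixes M N :: "'a::{real_normed_vector, second_countable_topology} measure"
  assumes M: "prob_space M" "sets M = sets borel" and N: "prob_space N" "sets N = sets borel"
    and char_eq: "\<And>f :: 'a \<Rightarrow>\<^sub>L real. (CLINT x|M. iexp (f x)) = (CLINT x|N. iexp (f x))"
  shows "M = N"
proof -
  interpret M: prob_space M by fact
  interpret N: prob_space N by fact
  note [measurable_cong] = M(2) N(2)
  \<comment> \<open>Multiplying by the constant \<open>iexp c\<close> shifts the phase, so
    characteristic functions determine all these cosine integrals.\<close>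
  have re: "(\<integral>x. cos (f x + c) \<partial>K) = Re (iexp c * (CLINT x|K. iexp (f x)))"
    if "prob_space K" and [measurable_cong]: "sets K = sets borel" for K c and f :: "'a \<Rightarrow>\<^sub>L real"
  proof -
    interpret prob_space K by fact
    have int: "integrable K (\<lambda>x. iexp c * iexp (f x))"
      by (rule integrable_const_bound[where B = 1]) (auto simp: norm_mult)
    have "iexp c * (CLINT x|K. iexp (f x)) = (CLINT x|K. iexp c * iexp (f x))" by simp
    also have "Re \<dots> = (\<integral>x. Re (iexp c * iexp (f x)) \<partial>K)"
      by (rule integral_Re[OF int, symmetric])
    also have "\<dots> = (\<integral>x. cos (f x + c) \<partial>K)"
      by (simp add: Re_exp Im_exp cos_add mult.commute)
    finally show ?thesis by simp
  qed
  have cos: "(\<integral>x. cos (f x + c) \<partial>M) = (\<integral>x. cos (f x + c) \<partial>N)" for f :: "'a \<Rightarrow>\<^sub>L real" and c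
    by (simp add: re[OF M] re[OF N] char_eq)
  let ?cyl = "\<lambda>xs :: (('a \<Rightarrow>\<^sub>L real) \<times> real set) list. {x. \<forall>(f, A)\<in>set xs. f x \<in> A}"
  let ?ok = "\<lambda>xs :: (('a \<Rightarrow>\<^sub>L real) \<times> real set) list. \<forall>(f, A)\<in>set xs. A \<in> sets borel"
  \<comment> \<open>The induction carries every cosine factor along, since adding a functional
    \<open>g\<close> to the list consumes cosines involving \<open>g\<close>. The choice
    \<open>f = 0\<close>, \<open>c = 0\<close> finally gives the measure of the cylinder.\<close>
  have cyl: "?cyl xs \<in> sets borel \<and> (\<forall>(f :: 'a \<Rightarrow>\<^sub>L real) c.
      (\<integral>x. indicator (?cyl xs) x * cos (f x + c) \<partial>M) = (\<integral>x. indicator (?cyl xs) x * cos (f x + c) \<partial>N))"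
    if "?ok xs" for xs
    using that
  proof (induction xs)
    case Nil
    show ?case by (simp add: cos)
  next
    case (Cons a xs)
    obtain g A where a: "a = (g, A)" by force
    have A: "A \<in> sets borel" and ok: "?ok xs" using Cons.prems by (auto simp: a)
    have eq: "?cyl (a # xs) = ?cyl xs \<inter> blinfun_apply g -` A" by (auto simp: a)
    have "blinfun_apply g -` A \<in> sets borel"
      using measurable_sets[OF borel_measurable_blinfun_apply A, of g] by simp
    with Cons.IH[OF ok] have "?cyl xs \<inter> blinfun_apply g -` A \<in> sets borel" by blast
    then show ?case
      unfolding eq using indicator_cos_integral_step[OF M N cos _ _ A] Cons.IH[OF ok] by simp
  qed
  let ?E = "?cyl ` {xs. ?ok xs}"
  have sets: "sigma_sets UNIV ?E = sets borel"
  proof (rule antisym)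
    show "sigma_sets UNIV ?E \<subseteq> sets borel"
      using sets.sigma_sets_subset[of ?E borel, OF image_subsetI] cyl
      by (simp only: space_borel mem_Collect_eq)
    have "sigma_sets UNIV {blinfun_apply f -` A | (f :: 'a \<Rightarrow>\<^sub>L real) A. A \<in> sets borel}
        \<subseteq> sigma_sets UNIV ?E"
    proof (rule sigma_sets_subseteq, rule subsetI)
      fix S assume "S \<in> {blinfun_apply f -` A | (f :: 'a \<Rightarrow>\<^sub>L real) A. A \<in> sets borel}"
      then obtain f :: "'a \<Rightarrow>\<^sub>L real" and A where "A \<in> sets borel" "S = blinfun_apply f -` A" by blast
      then show "S \<in> ?E" by (intro image_eqI[of _ _ "[(f, A)]"]) auto
    qed
    then show "sets borel \<subseteq> sigma_sets UNIV ?E"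
      by (simp only: sets_borel_eq_sigma_functionals[where 'a = 'a])
  qed
  show ?thesis
  proof (rule measure_eqI_generator_eq[where E = ?E and \<Omega> = UNIV and A = "\<lambda>_. UNIV"])
    show "Int_stable ?E"
    proof (rule Int_stableI)
      fix a b assume "a \<in> ?E" "b \<in> ?E"
      then obtain xs ys where "?ok xs" "?ok ys" "a = ?cyl xs" "b = ?cyl ys" by blast
      then show "a \<inter> b \<in> ?E" by (intro image_eqI[of _ _ "xs @ ys"]) auto
    qed
    fix X assume "X \<in> ?E"
    then obtain xs where ok: "?ok xs" and X: "X = ?cyl xs" by blast
    note c = cyl[OF ok, folded X]
    have "measure M X = measure N X"
      using c[THEN conjunct2, rule_format, of 0 0]
      by (simp add: sets_eq_imp_space_eq[OF M(2)] sets_eq_imp_space_eq[OF N(2)])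
    then show "emeasure M X = emeasure N X"
      by (simp add: M.emeasure_eq_measure N.emeasure_eq_measure)
  next
    show "range (\<lambda>_. UNIV) \<subseteq> ?E" by (auto intro!: image_eqI[of _ _ "[]"])
    show "sets M = sigma_sets UNIV ?E" "sets N = sigma_sets UNIV ?E"
      by (simp_all only: sets M(2) N(2))
  qed auto
qed

section \<open>Gaussian functionals and Fernique's theorem\<close>

context abstract_wiener_space
begin

lemma representer_exists:
  obtains h where "\<And>k. blinfun_apply e (j k) = h \<bullet> k"
  using dual_gaussian[of e] by blast

text \<open>The representer is unique: two of them have the same inner product with every vector, in
  particular with their difference. Hence the variance can be read off from any given one.\<close>

lemma distr_functional:
  assumes h: "\<And>k. blinfun_apply e (j k) = h \<bullet> k"
  shows "distr \<mu> borel (blinfun_apply e) = gaussian_measure 0 ((norm h)\<^sup>2)"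
proof -
  obtain h' where h': "\<And>k. blinfun_apply e (j k) = h' \<bullet> k"
    and d: "distr \<mu> borel (blinfun_apply e) = gaussian_measure 0 ((norm h')\<^sup>2)"
    using dual_gaussian[of e] by blast
  have "(h - h') \<bullet> (h - h') = 0" using h h' by (metis inner_diff_left right_minus_eq)
  then show ?thesis using d by simp
qed

lemma measurable_functional[measurable]: "blinfun_apply e \<in> borel_measurable \<mu>" for e :: "'w \<Rightarrow>\<^sub>L real"
  using sets_borel by (simp cong: measurable_cong_sets)

text \<open>A nonzero representer allows rescaling to the standard normal law. The zero one is
  separate, as its law is a point mass without density.\<close>

lemma char_functional:
  assumes h: "\<And>k. blinfun_apply e (j k) = h \<bullet> k"
  shows "(CLINT w|\<mu>. iexp (blinfun_apply e w)) = exp (- (norm h)\<^sup>2 / 2)"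
proof (cases "h = 0")
  case True
  have "(CLINT w|\<mu>. iexp (blinfun_apply e w)) = (CLINT x|distr \<mu> borel (blinfun_apply e). iexp x)"
    by (simp add: integral_distr)
  also have "\<dots> = (CLINT x|return borel 0. iexp x)"
    using distr_functional[OF h] True by (simp add: gaussian_measure_def)
  also have "\<dots> = 1" by (subst integral_return) auto
  finally show ?thesis using True by simp
next
  case False
  then have "distributed \<mu> lborel (blinfun_apply e) (normal_density 0 (norm h))"
    using distr_functional[OF h]
    by (simp add: distributed_def gaussian_measure_def cong: distr_cong)
  then have "distributed \<mu> lborel (\<lambda>w. (blinfun_apply e w - 0) / norm h) std_normal_density"
    using False normal_standard_normal_convert[of "norm h" "blinfun_apply e" 0] by simp
  then have "distr \<mu> lborel (\<lambda>w. blinfun_apply e w / norm h) = std_normal_distribution"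
    by (simp add: distributed_def)
  then have "char std_normal_distribution (norm h)
      = (CLINT x|distr \<mu> lborel (\<lambda>w. blinfun_apply e w / norm h). iexp (norm h * x))"
    by (simp add: char_def)
  also have "\<dots> = (CLINT w|\<mu>. iexp (norm h * (blinfun_apply e w / norm h)))"
    by (rule integral_distr) auto
  finally show ?thesis using False by (simp add: char_std_normal_distribution)
qed

section \<open>The product measure and its rotation\<close>

lemma char_functional_pair:
  fixes a b :: "'w \<Rightarrow>\<^sub>L real"
  assumes a: "\<And>k. a (j k) = h \<bullet> k" and b: "\<And>k. b (j k) = h' \<bullet> k"
  shows "(CLINT z|\<mu> \<Otimes>\<^sub>M \<mu>. iexp (a (fst z) + b (snd z))) = exp (- ((norm h)\<^sup>2 + (norm h')\<^sup>2) / 2)"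
proof -
  interpret P: pair_prob_space \<mu> \<mu> ..
  have "integrable (\<mu> \<Otimes>\<^sub>M \<mu>) (\<lambda>z. iexp (a (fst z) + b (snd z)))"
    by (rule P.P.integrable_const_bound[where B = 1]) auto
  then have "(CLINT z|\<mu> \<Otimes>\<^sub>M \<mu>. iexp (a (fst z) + b (snd z)))
      = (CLINT x|\<mu>. CLINT y|\<mu>. iexp (a x + b y))"
    using P.integral_fst'[of "\<lambda>z. iexp (a (fst z) + b (snd z))"] by simp
  also have "\<dots> = (CLINT x|\<mu>. CLINT y|\<mu>. iexp (a x) * iexp (b y))"
    by (simp add: exp_add distrib_left)
  also have "\<dots> = (CLINT x|\<mu>. iexp (a x)) * (CLINT y|\<mu>. iexp (b y))" by simp
  also have "\<dots> = exp (- ((norm h)\<^sup>2 + (norm h')\<^sup>2) / 2)"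
    unfolding char_functional[OF a] char_functional[OF b]
    by (simp add: exp_add[symmetric] of_real_mult[symmetric] add_divide_distrib del: of_real_mult of_real_exp)
  finally show ?thesis .
qed

text \<open>A functional on the product splits as \<open>a (fst z) + b (snd z)\<close>. Rotation
  replaces the representers \<open>h\<close>, \<open>h'\<close> by
  \<open>c *\<^sub>R (h + h')\<close> and \<open>c *\<^sub>R (h' - h)\<close>, and the parallelogram
  law preserves the sum of squared norms, hence the characteristic function.\<close>

lemma rotation_invariant:
  defines "R \<equiv> \<lambda>z :: 'w \<times> 'w. ((1 / sqrt 2) *\<^sub>R (fst z - snd z), (1 / sqrt 2) *\<^sub>R (fst z + snd z))"
  shows "R \<in> \<mu> \<Otimes>\<^sub>M \<mu> \<rightarrow>\<^sub>M \<mu> \<Otimes>\<^sub>M \<mu>" and "distr (\<mu> \<Otimes>\<^sub>M \<mu>) (\<mu> \<Otimes>\<^sub>M \<mu>) R = \<mu> \<Otimes>\<^sub>M \<mu>"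
proof -
  interpret P: pair_prob_space \<mu> \<mu> ..
  note [measurable_cong] = sets_borel
  have sets: "sets (\<mu> \<Otimes>\<^sub>M \<mu>) = sets borel"
    using sets_pair_measure_cong[OF sets_borel sets_borel] by (simp only: borel_prod)
  show R: "R \<in> \<mu> \<Otimes>\<^sub>M \<mu> \<rightarrow>\<^sub>M \<mu> \<Otimes>\<^sub>M \<mu>" unfolding R_def by measurable
  show "distr (\<mu> \<Otimes>\<^sub>M \<mu>) (\<mu> \<Otimes>\<^sub>M \<mu>) R = \<mu> \<Otimes>\<^sub>M \<mu>"
  proof (rule measure_eqI_functionals)
    show "prob_space (distr (\<mu> \<Otimes>\<^sub>M \<mu>) (\<mu> \<Otimes>\<^sub>M \<mu>) R)" by (rule P.P.prob_space_distr[OF R])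
    fix F :: "('w \<times> 'w) \<Rightarrow>\<^sub>L real"
    have bl: "bounded_linear (\<lambda>x. blinfun_apply F (x, 0))" "bounded_linear (\<lambda>y. blinfun_apply F (0, y))"
      by (intro bounded_linear_compose[OF blinfun.bounded_linear_right] bounded_linear_Pair
          bounded_linear_ident bounded_linear_zero)+
    define a b where "a = Blinfun (\<lambda>x. blinfun_apply F (x, 0))" and "b = Blinfun (\<lambda>y. blinfun_apply F (0, y))"
    have F: "F z = a (fst z) + b (snd z)" for z
      unfolding a_def b_def bounded_linear_Blinfun_apply[OF bl(1)] bounded_linear_Blinfun_apply[OF bl(2)]
      by (simp add: blinfun.add_right[symmetric])
    obtain h where h: "\<And>k. a (j k) = h \<bullet> k" using representer_exists by blast
    obtain h' where h': "\<And>k. b (j k) = h' \<bullet> k" using representer_exists by blast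
    define c where "c = 1 / sqrt 2"
    have c2: "c * c = 1 / 2" by (simp add: c_def)
    have FR: "F (R z) = (c *\<^sub>R (a + b)) (fst z) + (c *\<^sub>R (b - a)) (snd z)" for z
      unfolding F by (simp add: R_def c_def[symmetric] blinfun.bilinear_simps algebra_simps)
    have Fm: "(\<lambda>z. iexp (F z)) \<in> borel_measurable (\<mu> \<Otimes>\<^sub>M \<mu>)" unfolding F by measurable
    have "(CLINT z|distr (\<mu> \<Otimes>\<^sub>M \<mu>) (\<mu> \<Otimes>\<^sub>M \<mu>) R. iexp (F z)) = (CLINT z|\<mu> \<Otimes>\<^sub>M \<mu>. iexp (F (R z)))"
      by (rule integral_distr[OF R Fm])
    also have "\<dots> = exp (- ((norm (c *\<^sub>R (h + h')))\<^sup>2 + (norm (c *\<^sub>R (h' - h)))\<^sup>2) / 2)"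
      unfolding FR
      by (rule char_functional_pair) (simp_all add: blinfun.bilinear_simps h h' inner_simps)
    also have "(norm (c *\<^sub>R (h + h')))\<^sup>2 + (norm (c *\<^sub>R (h' - h)))\<^sup>2 = (norm h)\<^sup>2 + (norm h')\<^sup>2"
    proof -
      have "(norm (c *\<^sub>R (h + h')))\<^sup>2 + (norm (c *\<^sub>R (h' - h)))\<^sup>2
          = (c * c) * (2 * ((norm h)\<^sup>2 + (norm h')\<^sup>2))"
        by (simp add: power2_norm_eq_inner inner_simps inner_commute algebra_simps)
      then show ?thesis by (simp add: c2)
    qed
    also have "complex_of_real (exp (- ((norm h)\<^sup>2 + (norm h')\<^sup>2) / 2)) = (CLINT z|\<mu> \<Otimes>\<^sub>M \<mu>. iexp (F z))"
      unfolding F by (rule char_functional_pair[OF h h', symmetric])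
    finally show "(CLINT z|distr (\<mu> \<Otimes>\<^sub>M \<mu>) (\<mu> \<Otimes>\<^sub>M \<mu>) R. iexp (F z)) = (CLINT z|\<mu> \<Otimes>\<^sub>M \<mu>. iexp (F z))" .
  qed (simp_all add: sets P.P.prob_space_axioms)
qed

text \<open>If \<open>|x - y| \<le> \<surd>2 s\<close> and \<open>|x + y| > \<surd>2 t\<close> then both \<open>|x|\<close> and \<open>|y|\<close> exceed \<open>(t - s)/\<surd>2\<close>.\<close>
lemma fernique_inequality:
  "prob {w. norm w \<le> s} * prob {w. t < norm w} \<le> (prob {w. (t - s) / sqrt 2 < norm w})\<^sup>2"
proof -
  interpret P: pair_prob_space \<mu> \<mu> ..
  note [measurable_cong] = sets_borel
  let ?R = "\<lambda>z :: 'w \<times> 'w. ((1 / sqrt 2) *\<^sub>R (fst z - snd z), (1 / sqrt 2) *\<^sub>R (fst z + snd z))"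
  let ?P = "\<mu> \<Otimes>\<^sub>M \<mu>"
  define u where "u = (t - s) / sqrt 2"
  have S: "{w. norm w \<le> s} \<in> sets \<mu>" "{w. r < norm w} \<in> sets \<mu>" for r
    unfolding sets_borel by measurable
  let ?A = "{w. norm w \<le> s} \<times> {w. t < norm w}" and ?B = "{w. u < norm w} \<times> {w :: 'w. u < norm w}"
  have A: "?A \<in> sets ?P" and B: "?B \<in> sets ?P" using S by auto
  have times: "measure ?P (X \<times> Y) = prob X * prob Y" if "X \<in> sets \<mu>" "Y \<in> sets \<mu>" for X Y
    using emeasure_pair_measure_Times[OF that]
    by (simp add: emeasure_eq_measure P.P.emeasure_eq_measure ennreal_mult'[symmetric])
  have "prob {w. norm w \<le> s} * prob {w. t < norm w} = measure ?P ?A"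
    using times S by simp
  also have "\<dots> = measure (distr ?P ?P ?R) ?A" by (simp only: rotation_invariant(2))
  also have "\<dots> = measure ?P (?R -` ?A \<inter> space ?P)"
    by (rule measure_distr[OF rotation_invariant(1) A])
  also have "\<dots> \<le> measure ?P ?B"
  proof (rule P.P.finite_measure_mono[OF _ B], rule subsetI)
    fix z assume "z \<in> ?R -` ?A \<inter> space ?P"
    then have "norm (fst z - snd z) / sqrt 2 \<le> s" "t < norm (fst z + snd z) / sqrt 2"
      by auto
    then have *: "norm (fst z - snd z) \<le> sqrt 2 * s" "sqrt 2 * t < norm (fst z + snd z)"
      by (simp_all add: pos_divide_le_eq pos_less_divide_eq mult.commute)
    have "norm (fst z + snd z) \<le> norm (fst z - snd z) + 2 * norm (snd z)"
      using norm_triangle_ineq[of "fst z - snd z" "snd z + snd z"] norm_triangle_ineq[of "snd z" "snd z"]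
      by simp
    moreover have "norm (fst z + snd z) \<le> norm (snd z - fst z) + 2 * norm (fst z)"
      using norm_triangle_ineq[of "snd z - fst z" "fst z + fst z"] norm_triangle_ineq[of "fst z" "fst z"]
      by (simp add: add.commute)
    moreover have "2 * u = sqrt 2 * t - sqrt 2 * s"
      unfolding u_def by (simp add: field_simps) 
    ultimately have "u < norm (fst z)" "u < norm (snd z)"
      using * by (auto simp: norm_minus_commute)
    then show "z \<in> ?B" by (cases z) auto
  qed
  also have "\<dots> = (prob {w. u < norm w})\<^sup>2" using times S by (simp add: power2_eq_square)
  finally show ?thesis unfolding u_def .
qed

section \<open>Tails and first moment of the norm\<close>

lemma norm_tail_tendsto_0: "((\<lambda>t. prob {w. t < norm w}) \<longlongrightarrow> 0) at_top"
proof -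
  note [measurable_cong] = sets_borel
  interpret D: real_distribution "distr \<mu> borel norm"
    by (rule real_distribution_distr) measurable
  have "prob {w. t < norm w} = 1 - cdf (distr \<mu> borel norm) t" for t
  proof -
    have sp: "space \<mu> = UNIV" using sets_eq_imp_space_eq[OF sets_borel] by simp
    have "{w. t < norm w} = space \<mu> - {w. norm w \<le> t}" by (auto simp: sp)
    moreover have "{w. norm w \<le> t} \<in> sets \<mu>" unfolding sets_borel by measurable
    moreover have "cdf (distr \<mu> borel norm) t = prob {w. norm w \<le> t}"
      unfolding cdf_def by (subst measure_distr) (auto simp: sp vimage_def)
    ultimately show ?thesis using prob_compl by simp
  qed
  moreover have "((\<lambda>t. 1 - cdf (distr \<mu> borel norm) t) \<longlongrightarrow> 1 - 1) at_top"
    by (intro tendsto_intros D.cdf_lim_at_top_prob)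
  ultimately show ?thesis by simp
qed

text \<open>Fernique's inequality bounds the tail at a doubled threshold by twice the square of the
  previous tail. Once small, the tails shrink by a factor \<open>1 / 8\<close> per doubling, which
  outweighs the growth of the thresholds.\<close>

lemma nn_integral_norm_finite: "(\<integral>\<^sup>+w. ennreal (norm w) \<partial>\<mu>) < \<infinity>"
proof -
  note [measurable_cong] = sets_borel
  let ?g = "\<lambda>t. prob {w. t < norm w}"
  \<comment> \<open>A tail below \<open>1 / 16\<close> makes \<open>2 * (?g (t n))\<^sup>2\<close>
    at most one eighth of \<open>?g (t n)\<close>.\<close>
  have ev: "\<forall>\<^sub>F t in at_top. ?g t < 1 / 16"
    using norm_tail_tendsto_0 by (rule order_tendstoD) simp
  then obtain s where s: "?g s < 1 / 16" "0 < s"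
    using eventually_happens'[OF _ eventually_conj[OF ev eventually_gt_at_top[of 0]]] by auto
  have sp: "space \<mu> = UNIV" using sets_eq_imp_space_eq[OF sets_borel] by simp
  have le: "{w. norm w \<le> s} = space \<mu> - {w. s < norm w}" by (auto simp: sp)
  have m: "{w. t < norm w} \<in> sets \<mu>" for t unfolding sets_borel by measurable
  have "prob {w. norm w \<le> s} \<ge> 1 / 2" using prob_compl[OF m] s by (simp add: le)
  then have half: "?g t / 2 \<le> prob {w. norm w \<le> s} * ?g t" for t
    using mult_right_mono[of "1 / 2" _ "?g t"] by simp
  \<comment> \<open>Since \<open>sqrt 2 \<le> 3 / 2\<close>, the bound
    \<open>t n \<le> (t (Suc n) - s) / sqrt 2\<close> holds as soon as
    \<open>t n \<ge> 2 * s\<close>, which the starting value \<open>4 * s\<close>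
    guarantees.\<close>
  define t where "t n = 2 ^ n * (4 * s)" for n :: nat
  have t_ge: "4 * s \<le> t n" for n
    unfolding t_def using s(2) mult_right_mono[of 1 "2 ^ n" "4 * s"] by simp
  have step: "?g (t (Suc n)) \<le> 2 * (?g (t n))\<^sup>2" for n
  proof -
    have "sqrt 2 \<le> 3 / 2" by (rule real_le_lsqrt) (auto simp: power2_eq_square)
    then have "t n * sqrt 2 \<le> t n * (3 / 2)"
      using t_ge[of n] s(2) by (intro mult_left_mono) auto
    also have "\<dots> \<le> 2 * t n - s" using t_ge[of n] s(2) by simp
    finally have "t n \<le> (t (Suc n) - s) / sqrt 2"
      by (simp add: field_simps t_def)
    then have "?g ((t (Suc n) - s) / sqrt 2) \<le> ?g (t n)"
      by (intro finite_measure_mono m) auto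
    then have "(?g ((t (Suc n) - s) / sqrt 2))\<^sup>2 \<le> (?g (t n))\<^sup>2"
      by (intro power_mono) auto
    then show ?thesis
      using fernique_inequality[of s "t (Suc n)"] half[of "t (Suc n)"] by linarith
  qed
  have decay: "?g (t n) \<le> (1 / 16) * (1 / 8) ^ n" for n
  proof (induction n)
    case 0
    have "?g (t 0) \<le> ?g s" using s(2) by (intro finite_measure_mono m) (auto simp: t_def)
    then show ?case using s by simp
  next
    case (Suc n)
    have "(1 / 8 :: real) ^ n \<le> 1" by (simp add: power_le_one)
    then have "?g (t n) \<le> 1 / 16" using Suc by linarith
    then have "?g (t n) * ?g (t n) \<le> (1 / 16) * ?g (t n)" by (intro mult_right_mono) auto
    then have "?g (t (Suc n)) \<le> (1 / 8) * ?g (t n)"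
      using step[of n] by (simp add: power2_eq_square)
    then show ?case using Suc by simp
  qed
  have pointwise: "ennreal (norm w) \<le> ennreal (4 * s)
      + (\<Sum>n. ennreal (t (Suc n)) * indicator {w. t n < norm w} w)" (is "_ \<le> _ + suminf ?f") for w :: 'w
  proof (cases "norm w \<le> 4 * s")
    case True
    then show ?thesis by (simp add: add_increasing2 ennreal_leI)
  next
    case False
    have "\<exists>n. norm w \<le> t n"
    proof -
      obtain n where "norm w / (4 * s) < 2 ^ n" using real_arch_pow[of 2 "norm w / (4 * s)"] by auto
      then show ?thesis using s(2) by (auto simp: t_def field_simps intro!: exI[of _ n])
    qed
    moreover have "\<not> norm w \<le> t 0" using False by (simp add: t_def)
    \<comment> \<open>The norm lies between two consecutive thresholds, so the single term of index
      \<open>n\<close> already dominates it.\<close>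
    ultimately obtain n where n: "\<not> norm w \<le> t n" "norm w \<le> t (Suc n)"
      using ex_least_nat_less[of "\<lambda>n. norm w \<le> t n"] by blast
    then have "ennreal (norm w) \<le> ?f n" by (simp add: ennreal_leI)
    also have "?f n \<le> suminf ?f"
    proof -
      have "f n \<le> suminf f" for f :: "nat \<Rightarrow> ennreal"
        using sum_le_suminf[of f "{n}"] by (simp add: summableI)
      then show ?thesis .
    qed
    finally show ?thesis by (simp add: add_increasing)
  qed
  have "(\<integral>\<^sup>+w. ennreal (norm w) \<partial>\<mu>)
      \<le> (\<integral>\<^sup>+w. ennreal (4 * s) + (\<Sum>n. ennreal (t (Suc n)) * indicator {w. t n < norm w} w) \<partial>\<mu>)"
    by (rule nn_integral_mono) (rule pointwise)
  also have "\<dots> = ennreal (4 * s) + (\<Sum>n. ennreal (t (Suc n)) * ennreal (?g (t n)))"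
    using m by (simp add: nn_integral_add nn_integral_suminf nn_integral_cmult_indicator
        emeasure_eq_measure prob_space)
  also have "(\<Sum>n. ennreal (t (Suc n)) * ennreal (?g (t n))) \<le> (\<Sum>n. ennreal (s / 2 * (1 / 4) ^ n))"
  proof (rule suminf_le)
    fix n
    have "t (Suc n) * ?g (t n) \<le> t (Suc n) * ((1 / 16) * (1 / 8) ^ n)"
      using t_ge[of "Suc n"] s(2) by (intro mult_left_mono decay) auto
    also have "\<dots> = s / 2 * (1 / 4) ^ n"
      by (simp add: t_def power_mult_distrib[symmetric] power_divide)
        (simp add: field_simps power_mult_distrib[symmetric])
    finally show "ennreal (t (Suc n)) * ennreal (?g (t n)) \<le> ennreal (s / 2 * (1 / 4) ^ n)"
      using t_ge[of "Suc n"] s(2) by (simp add: ennreal_mult[symmetric] ennreal_leI)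
  qed auto
  also have "(\<Sum>n. ennreal (s / 2 * (1 / 4) ^ n)) = ennreal (\<Sum>n. s / 2 * (1 / 4) ^ n)"
    using s(2) by (intro suminf_ennreal2) (auto intro!: summable_mult summable_geometric)
  finally show ?thesis
    by (auto simp: less_top[symmetric] top_unique)
qed

end

text \<open>A functional with zero representer vanishes on the dense range of \<open>j\<close>,
  hence everywhere. A nonzero one thus has positive variance and a law with a density. This makes
  the measure of its sublevel sets vary continuously.\<close>

lemma (in abstract_wiener_space) functional_point_null:
  assumes e: "e \<noteq> (0 :: 'w \<Rightarrow>\<^sub>L real)"
  shows "prob {w. blinfun_apply e w = c} = 0"
proof -
  obtain h where h: "\<And>k. blinfun_apply e (j k) = h \<bullet> k" using representer_exists by blast
  have sp: "space \<mu> = UNIV" using sets_eq_imp_space_eq[OF sets_borel] by simp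
  have "h \<noteq> 0"
  proof
    assume "h = 0"
    have "blinfun_apply e w = 0" for w
    proof (rule continuous_constant_on_closure[of "range j" "blinfun_apply e" 0 w])
      show "continuous_on (closure (range j)) (blinfun_apply e)"
        by (intro linear_continuous_on blinfun.bounded_linear_right)
    qed (use h \<open>h = 0\<close> embedding_dense in auto)
    then show False using e by (auto intro: blinfun_eqI)
  qed
  have "prob {w. blinfun_apply e w = c} = measure (distr \<mu> borel (blinfun_apply e)) {c}"
    by (subst measure_distr) (auto simp: sp vimage_def)
  also have "\<dots> = measure (density lborel (\<lambda>x. ennreal (normal_density 0 (norm h) x))) {c}"
    unfolding distr_functional[OF h] gaussian_measure_def using \<open>h \<noteq> 0\<close> by simp
  also have "\<dots> = 0"
  proof -
    have "AE x in lborel. x \<noteq> c" by (rule AE_lborel_singleton)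
    then have "emeasure (density lborel (\<lambda>x. ennreal (normal_density 0 (norm h) x))) {c} = 0"
      by (subst emeasure_density) (auto simp: nn_integral_0_iff_AE indicator_def)
    then show ?thesis by (simp add: measure_def)
  qed
  finally show ?thesis .
qed

section \<open>First-return maps\<close>

text \<open>Points of \<open>A\<close> that never return are left fixed, so the map is total.
  Counting times from \<open>Suc n\<close> excludes the trivial return at time zero.\<close>

definition induced_map :: "('a \<Rightarrow> 'a) \<Rightarrow> 'a set \<Rightarrow> 'a \<Rightarrow> 'a" where
  "induced_map T A x =
     (if x \<in> A \<and> (\<exists>n. (T ^^ Suc n) x \<in> A) then (T ^^ Suc (LEAST n. (T ^^ Suc n) x \<in> A)) x else x)"

definition first_return_into :: "('a \<Rightarrow> 'a) \<Rightarrow> 'a set \<Rightarrow> 'a set \<Rightarrow> nat \<Rightarrow> 'a set" where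
  "first_return_into T A B n = {x\<in>A. (T ^^ Suc n) x \<in> B \<and> (\<forall>k<n. (T ^^ Suc k) x \<notin> A)}"

lemma Least_first_return:
  fixes T :: "'a \<Rightarrow> 'a"
  assumes "(T ^^ Suc n) x \<in> A" "\<forall>k<n. (T ^^ Suc k) x \<notin> A"
  shows "(LEAST k. (T ^^ Suc k) x \<in> A) = n"
  using assms by (intro Least_equality) (auto simp: not_less[symmetric])

lemma induced_map_eq:
  assumes "x \<in> first_return_into T A A n" shows "induced_map T A x = (T ^^ Suc n) x"
proof -
  have "x \<in> A" and n: "(T ^^ Suc n) x \<in> A" "\<forall>k<n. (T ^^ Suc k) x \<notin> A"
    using assms unfolding first_return_into_def by auto
  then have "\<exists>n. (T ^^ Suc n) x \<in> A" by blast
  with \<open>x \<in> A\<close> show ?thesis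
    unfolding induced_map_def Least_first_return[OF n] by argo
qed

lemma induced_map_no_return:
  assumes "x \<notin> (\<Union>n. first_return_into T A A n)" shows "induced_map T A x = x"
proof -
  have "\<not> (x \<in> A \<and> (\<exists>n. (T ^^ Suc n) x \<in> A))"
  proof
    assume *: "x \<in> A \<and> (\<exists>n. (T ^^ Suc n) x \<in> A)"
    define m where "m = (LEAST n. (T ^^ Suc n) x \<in> A)"
    have "(T ^^ Suc m) x \<in> A" unfolding m_def by (rule LeastI_ex) (use * in blast)
    moreover have "\<forall>k<m. (T ^^ Suc k) x \<notin> A" unfolding m_def using not_less_Least by blast
    ultimately show False using * assms unfolding first_return_into_def by blast
  qed
  then show ?thesis unfolding induced_map_def by argo
qed

text \<open>The preimage splits into the points fixed for lack of a return and countably many pieces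
  indexed by the return time, each described by finitely many iterates of \<open>T\<close>.\<close>

lemma induced_map_vimage:
  assumes "A \<subseteq> S"
  shows "induced_map T A -` B \<inter> S =
    (B \<inter> (S - (\<Union>n. first_return_into T A A n))) \<union> (\<Union>n. first_return_into T A (A \<inter> B) n)"
    (is "?L = ?R")
proof (intro set_eqI)
  fix x
  show "x \<in> ?L \<longleftrightarrow> x \<in> ?R"
  proof (cases "x \<in> (\<Union>n. first_return_into T A A n)")
    case False
    then have "x \<notin> (\<Union>n. first_return_into T A (A \<inter> B) n)"
      unfolding first_return_into_def by blast
    then show ?thesis using False induced_map_no_return[OF False] by auto
  next
    case True
    then obtain n where n: "x \<in> first_return_into T A A n" by blast
    then have "x \<in> S" using assms unfolding first_return_into_def by auto
    moreover have "x \<in> first_return_into T A (A \<inter> B) m \<Longrightarrow> m = n" for m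
      using n Least_first_return[of m T x A] Least_first_return[of n T x A]
      unfolding first_return_into_def by blast
    moreover have "(T ^^ Suc n) x \<in> B \<longleftrightarrow> x \<in> first_return_into T A (A \<inter> B) n"
      using n unfolding first_return_into_def by blast
    ultimately show ?thesis using True induced_map_eq[OF n] by auto
  qed
qed

lemma disjoint_family_first_return_into:
  assumes "B \<subseteq> A" shows "disjoint_family (first_return_into T A B)"
proof -
  have "m = n" if "x \<in> first_return_into T A B m" "x \<in> first_return_into T A B n" for x m n
  proof -
    have "(LEAST k. (T ^^ Suc k) x \<in> A) = m" "(LEAST k. (T ^^ Suc k) x \<in> A) = n"
      using that assms unfolding first_return_into_def by (blast intro!: Least_first_return)+
    then show ?thesis by simp
  qed
  then show ?thesis unfolding disjoint_family_on_def by blast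
qed

text \<open>Preimages under \<open>T\<close> split the points entering \<open>B\<close> at time \<open>n + 1\<close> according to whether they start
  in \<open>A\<close>; summing over \<open>n\<close> telescopes.\<close>
lemma (in prob_space) first_return_into_measure:
  assumes T: "measure_preserving M T" and A: "A \<in> sets M" and B: "B \<in> sets M" and "B \<subseteq> A"
  shows "first_return_into T A B n \<in> sets M"
    and "prob (\<Union>n. first_return_into T A B n) = prob B"
proof -
  have Tm[measurable]: "T \<in> M \<rightarrow>\<^sub>M M" and Td: "distr M M T = M"
    using T unfolding measure_preserving_def by auto
  have pow[measurable]: "(T ^^ n) \<in> M \<rightarrow>\<^sub>M M" for n
    by (rule measurable_compose_n) (rule Tm)
  note [measurable] = A B
  have sp: "A \<subseteq> space M" "B \<subseteq> space M" using A B by (simp_all add: sets.sets_into_space)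
  define R where "R = first_return_into T A B"
  have R_eq: "R n = {x\<in>space M. x \<in> A \<and> (T ^^ Suc n) x \<in> B \<and> (\<forall>k<n. (T ^^ Suc k) x \<notin> A)}" for n
    unfolding R_def first_return_into_def using sp by auto
  have Rm: "R n \<in> sets M" for n unfolding R_eq by measurable
  then show "first_return_into T A B n \<in> sets M" unfolding R_def .
  \<comment> \<open>As \<open>B \<subseteq> A\<close>, these are the points whose first visit to
    \<open>A\<close>, time zero included, occurs at time \<open>n\<close> and lands in
    \<open>B\<close>. Distinct times exclude each other, so the masses are summable and the
    telescoping remainder vanishes.\<close>
  define V where "V n = {x\<in>space M. (T ^^ n) x \<in> B \<and> (\<forall>k<n. (T ^^ k) x \<notin> A)}" for n
  have Vm: "V n \<in> sets M" for n unfolding V_def by measurable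
  have "V n \<inter> V m = {}" if "n < m" for n m
    using that \<open>B \<subseteq> A\<close> unfolding V_def by auto
  then have disj: "disjoint_family V"
    unfolding disjoint_family_on_def by (metis Int_commute nat_neq_iff)
  have "(\<lambda>n. prob (V n)) sums prob (\<Union>n. V n)"
    using Vm disj by (intro finite_measure_UNION) auto
  then have lim: "(\<lambda>n. prob (V n)) \<longlonglongrightarrow> 0" by (intro summable_LIMSEQ_zero sums_summable)
  have step: "prob (R n) = prob (V n) - prob (V (Suc n))" for n
  proof -
    have "T -` V n \<inter> space M = R n \<union> V (Suc n)"
      using measurable_space[OF Tm]
      by (auto simp: V_def R_eq funpow_Suc_right less_Suc_eq_0_disj simp del: funpow.simps)
    moreover have "R n \<inter> V (Suc n) = {}" by (auto simp: V_def R_eq)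
    ultimately have "prob (T -` V n \<inter> space M) = prob (R n) + prob (V (Suc n))"
      using Rm Vm by (simp add: finite_measure_Union)
    moreover have "prob (T -` V n \<inter> space M) = prob (V n)"
      using measure_distr[OF Tm Vm] by (simp add: Td)
    ultimately show ?thesis by simp
  qed
  have "(\<lambda>n. prob (R n)) sums (prob (V 0) - 0)"
    unfolding step by (rule telescope_sums'[OF lim])
  moreover have "V 0 = B" using sp by (auto simp: V_def)
  moreover have "(\<lambda>n. prob (R n)) sums prob (\<Union>n. R n)"
    using Rm disjoint_family_first_return_into[OF \<open>B \<subseteq> A\<close>, of T]
    unfolding R_def[symmetric] by (intro finite_measure_UNION) auto
  ultimately show "prob (\<Union>n. first_return_into T A B n) = prob B"
    unfolding R_def by (metis diff_zero sums_unique2)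
qed

text \<open>The returning part of the preimage of \<open>B\<close> has the mass of
  \<open>A \<inter> B\<close>. The fixed part equals \<open>B - A\<close> up to a null set, because
  almost every point of \<open>A\<close> returns.\<close>

lemma (in prob_space) measure_preserving_induced_map:
  assumes T: "measure_preserving M T" and A: "A \<in> sets M"
  shows "measure_preserving M (induced_map T A)"
proof -
  let ?R = "\<lambda>B. \<Union>n. first_return_into T A B n"
  have sp: "A \<subseteq> space M" using A sets.sets_into_space by auto
  have Rm: "?R (A \<inter> B) \<in> sets M" and Rp: "prob (?R (A \<inter> B)) = prob (A \<inter> B)"
    if "B \<in> sets M" for B
    using first_return_into_measure[OF T A, of "A \<inter> B"] A that by auto
  have RA: "?R A \<in> sets M" "prob (?R A) = prob A" "?R A \<subseteq> A"
    using Rm[OF A] Rp[OF A] by (auto simp: first_return_into_def)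
  have vim: "induced_map T A -` B \<inter> space M = (B \<inter> (space M - ?R A)) \<union> ?R (A \<inter> B)" for B
    by (rule induced_map_vimage[OF sp])
  have vimm: "induced_map T A -` B \<inter> space M \<in> sets M" if "B \<in> sets M" for B
    unfolding vim using Rm[OF that] RA(1) that by auto
  have vimp: "prob (induced_map T A -` B \<inter> space M) = prob B" if B: "B \<in> sets M" for B
  proof -
    have "?R (A \<inter> B) \<subseteq> ?R A" by (auto simp: first_return_into_def)
    then have "prob (induced_map T A -` B \<inter> space M)
        = prob (B \<inter> (space M - ?R A)) + prob (A \<inter> B)"
      unfolding vim Rp[OF B, symmetric] using Rm[OF B] RA(1) B
      by (intro finite_measure_Union) auto
    also have "prob (B \<inter> (space M - ?R A)) = prob (B - A)"
    proof (rule measure_eq_AE)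
      \<comment> \<open>Poincare recurrence: the returning subset of \<open>A\<close> has the same
        finite mass as \<open>A\<close>.\<close>
      have "prob (A - ?R A) = 0"
        using finite_measure_Diff[OF A RA(1,3)] RA(2) by simp
      then have "AE x in M. x \<notin> A - ?R A"
        using A RA(1) by (subst AE_iff_measurable[of "A - ?R A"])
          (auto simp: emeasure_eq_measure dest: subsetD[OF sp])
      then show "AE x in M. x \<in> B \<inter> (space M - ?R A) \<longleftrightarrow> x \<in> B - A"
        using AE_space
      proof eventually_elim
        case (elim x)
        then show ?case using RA(3) by blast
      qed
    qed (use A B RA(1) in auto)
    also have "prob (B - A) + prob (A \<inter> B) = prob B"
      using finite_measure_Union[of "B - A" "A \<inter> B"] A B
      by (simp add: Int_commute[of A] Un_Diff_Int Diff_Int2 disjoint_iff)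
    finally show ?thesis .
  qed
  have m: "induced_map T A \<in> M \<rightarrow>\<^sub>M M"
  proof (rule measurableI)
    show "induced_map T A x \<in> space M" if "x \<in> space M" for x
    proof (cases "x \<in> ?R A")
      case True
      then obtain n where n: "x \<in> first_return_into T A A n" by blast
      then show ?thesis unfolding induced_map_eq[OF n] using sp by (auto simp: first_return_into_def)
    next
    case False
    then show ?thesis using that by (simp only: induced_map_no_return simp_thms)
  qed
  qed (rule vimm)
  have "distr M M (induced_map T A) = M"
    using m by (intro measure_eqI) (auto simp: emeasure_distr emeasure_eq_measure vimp)
  with m show ?thesis unfolding measure_preserving_def by simp
qed

section \<open>Return maps to nested sets\<close>

lemma induced_map_empty: "induced_map T {} x = x" and induced_map_UNIV: "induced_map T UNIV x = T x"
  unfolding induced_map_def by (auto simp: Least_equality)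

text \<open>A visit to \<open>A\<close> is a visit to \<open>B\<close>. So a first return to
  \<open>B\<close> that starts and ends in \<open>A\<close> is also the first return to
  \<open>A\<close>, and a point without return to \<open>B\<close> has none to
  \<open>A\<close>.\<close>

lemma induced_map_eq_if_mono:
  assumes "A \<subseteq> B" and "x \<notin> B - A" and "induced_map T B x \<notin> B - A"
  shows "induced_map T A x = induced_map T B x"
proof (cases "x \<in> (\<Union>n. first_return_into T B B n)")
  case False
  have "x \<notin> (\<Union>n. first_return_into T A A n)"
  proof
    assume "x \<in> (\<Union>n. first_return_into T A A n)"
    then obtain n where n: "(T ^^ Suc n) x \<in> A" "x \<in> A" by (auto simp: first_return_into_def simp del: funpow.simps)
    define m where "m = (LEAST n. (T ^^ Suc n) x \<in> B)"
    have "(T ^^ Suc m) x \<in> B" unfolding m_def by (rule LeastI_ex) (use n assms(1) in blast)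
    moreover have "\<forall>k<m. (T ^^ Suc k) x \<notin> B" unfolding m_def using not_less_Least by blast
    ultimately show False using n assms(1) False unfolding first_return_into_def by blast
  qed
  then show ?thesis using False by (simp only: induced_map_no_return simp_thms)
next
  case True
  then obtain n where n: "x \<in> first_return_into T B B n" by blast
  then have "x \<in> first_return_into T A A n"
    using assms unfolding induced_map_eq[OF n] first_return_into_def by blast
  then show ?thesis using n by (simp only: induced_map_eq)
qed

section \<open>Continuity of the path of return maps\<close>

text \<open>On \<open>E\<close> the difference is at most the sum of the two norms, each bounded by
  \<open>K\<close> plus its excess term. Measure preservation makes the excess integrals independent
  of \<open>S\<close> and \<open>T\<close>, so the bound is uniform in both maps.\<close>

lemma nn_integral_diff_measure_preserving_le:
  fixes M :: "'a::{real_normed_vector, second_countable_topology} measure"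
    and S T :: "'a \<Rightarrow> 'a" and K :: real
  assumes P: "prob_space M" and M: "sets M = sets borel"
    and S: "measure_preserving M S" and T: "measure_preserving M T"
    and E: "E \<in> sets M" "\<And>w. w \<notin> E \<Longrightarrow> S w = T w"
  shows "(\<integral>\<^sup>+w. ennreal (norm (S w - T w)) \<partial>M)
    \<le> 2 * (ennreal K * emeasure M E + (\<integral>\<^sup>+w. ennreal (norm w) * indicator {w. K < norm w} w \<partial>M))"
proof -
  interpret prob_space M by (rule P)
  note [measurable_cong] = M
  note [measurable] = E(1)
  let ?r = "\<lambda>w. ennreal (norm w) * indicator {w. K < norm w} w"
  have rm: "?r \<in> borel_measurable M" by measurable
  have part: "(\<integral>\<^sup>+w. ennreal K * indicator E w + ?r (R w) \<partial>M) = ennreal K * emeasure M E + integral\<^sup>N M ?r"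
    and part_m: "(\<lambda>w. ennreal K * indicator E w + ?r (R w)) \<in> borel_measurable M"
    if "measure_preserving M R" for R
  proof -
    have R: "R \<in> M \<rightarrow>\<^sub>M M" and d: "distr M M R = M"
      using that unfolding measure_preserving_def by auto
    have [measurable]: "(\<lambda>w. ?r (R w)) \<in> borel_measurable M"
      by (rule measurable_compose[OF R rm])
    show "(\<lambda>w. ennreal K * indicator E w + ?r (R w)) \<in> borel_measurable M" by measurable
    have "(\<integral>\<^sup>+w. ?r (R w) \<partial>M) = integral\<^sup>N (distr M M R) ?r"
      by (rule nn_integral_distr[OF R, symmetric]) (simp add: rm)
    then show "(\<integral>\<^sup>+w. ennreal K * indicator E w + ?r (R w) \<partial>M) = ennreal K * emeasure M E + integral\<^sup>N M ?r"
      unfolding d by (subst nn_integral_add) (auto simp: nn_integral_cmult_indicator)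
  qed
  have le: "ennreal (norm w) \<le> ennreal K + ?r w" for w :: 'a
    by (cases "K < norm w") (auto simp: ennreal_leI add_increasing)
  have "ennreal (norm (S w - T w))
      \<le> (ennreal K * indicator E w + ?r (S w)) + (ennreal K * indicator E w + ?r (T w))" for w
  proof (cases "w \<in> E")
    case True
    have "ennreal (norm (S w - T w)) \<le> ennreal (norm (S w)) + ennreal (norm (T w))"
      by (simp add: ennreal_plus[symmetric] ennreal_leI norm_triangle_ineq4 del: ennreal_plus)
    also have "\<dots> \<le> (ennreal K + ?r (S w)) + (ennreal K + ?r (T w))"
      by (intro add_mono le)
    finally show ?thesis using True by simp
  qed (simp add: E(2))
  then have "(\<integral>\<^sup>+w. ennreal (norm (S w - T w)) \<partial>M) \<le>
      (\<integral>\<^sup>+w. (ennreal K * indicator E w + ?r (S w)) + (ennreal K * indicator E w + ?r (T w)) \<partial>M)"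
    by (intro nn_integral_mono) auto
  also have "\<dots> = (\<integral>\<^sup>+w. ennreal K * indicator E w + ?r (S w) \<partial>M)
      + (\<integral>\<^sup>+w. ennreal K * indicator E w + ?r (T w) \<partial>M)"
    by (rule nn_integral_add[OF part_m[OF S] part_m[OF T]])
  also have "\<dots> = 2 * (ennreal K * emeasure M E + integral\<^sup>N M ?r)"
    unfolding part[OF S] part[OF T] by (simp add: mult_2)
  finally show ?thesis .
qed

text \<open>The exceptional set is \<open>B - A\<close> together with its preimage under the return
  map to \<open>B\<close>. Both have the same mass, whence the inner factor
  \<open>2\<close>.\<close>

lemma nn_integral_diff_induced_map_le:
  fixes M :: "'a::{real_normed_vector, second_countable_topology} measure"
    and T :: "'a \<Rightarrow> 'a" and K :: real
  assumes P: "prob_space M" and M: "sets M = sets borel" and T: "measure_preserving M T"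
    and A: "A \<in> sets M" and B: "B \<in> sets M" and "A \<subseteq> B" and "0 \<le> K"
  shows "(\<integral>\<^sup>+w. ennreal (norm (induced_map T A w - induced_map T B w)) \<partial>M)
    \<le> 2 * (ennreal (K * (2 * (measure M B - measure M A)))
      + (\<integral>\<^sup>+w. ennreal (norm w) * indicator {w. K < norm w} w \<partial>M))"
proof -
  interpret prob_space M by (rule P)
  have TA: "measure_preserving M (induced_map T A)" and TB: "measure_preserving M (induced_map T B)"
    using measure_preserving_induced_map[OF T] A B by auto
  then have m: "induced_map T B \<in> M \<rightarrow>\<^sub>M M" and d: "distr M M (induced_map T B) = M"
    unfolding measure_preserving_def by auto
  have sp: "space M = UNIV" using sets_eq_imp_space_eq[OF M] by simp
  have D: "B - A \<in> sets M" using A B by auto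
  let ?V = "induced_map T B -` (B - A) \<inter> space M"
  have V: "?V \<in> sets M" by (rule measurable_sets[OF m D])
  have "prob ?V = measure (distr M M (induced_map T B)) (B - A)"
    by (rule measure_distr[OF m D, symmetric])
  then have "prob ?V = prob (B - A)" by (simp only: d)
  then have "prob ((B - A) \<union> ?V) \<le> 2 * prob (B - A)"
    using measure_subadditive[OF D V] by (simp add: emeasure_eq_measure)
  also have "prob (B - A) = prob B - prob A" by (rule finite_measure_Diff[OF B A \<open>A \<subseteq> B\<close>])
  finally have p: "K * prob ((B - A) \<union> ?V) \<le> K * (2 * (prob B - prob A))"
    using \<open>0 \<le> K\<close> by (rule mult_left_mono)
  have "(\<integral>\<^sup>+w. ennreal (norm (induced_map T A w - induced_map T B w)) \<partial>M)
    \<le> 2 * (ennreal K * emeasure M ((B - A) \<union> ?V)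
      + (\<integral>\<^sup>+w. ennreal (norm w) * indicator {w. K < norm w} w \<partial>M))"
    using induced_map_eq_if_mono[OF \<open>A \<subseteq> B\<close>] sp
    by (intro nn_integral_diff_measure_preserving_le[OF P M TA TB] sets.Un D V) auto
  also have "ennreal K * emeasure M ((B - A) \<union> ?V) = ennreal (K * prob ((B - A) \<union> ?V))"
    using \<open>0 \<le> K\<close> by (simp add: emeasure_eq_measure ennreal_mult)
  also have "2 * (ennreal (K * prob ((B - A) \<union> ?V))
      + (\<integral>\<^sup>+w. ennreal (norm w) * indicator {w. K < norm w} w \<partial>M))
    \<le> 2 * (ennreal (K * (2 * (prob B - prob A)))
      + (\<integral>\<^sup>+w. ennreal (norm w) * indicator {w. K < norm w} w \<partial>M))"
    by (rule mult_left_mono[OF add_right_mono[OF ennreal_leI[OF p]]]) simp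
  finally show ?thesis .
qed

lemma nn_integral_norm_tail_tendsto_0:
  fixes M :: "'a::{real_normed_vector, second_countable_topology} measure"
  assumes M: "sets M = sets borel" and fin: "(\<integral>\<^sup>+w. ennreal (norm w) \<partial>M) < \<infinity>"
  shows "(\<lambda>n :: nat. \<integral>\<^sup>+w. ennreal (norm w) * indicator {w. real n < norm w} w \<partial>M) \<longlonglongrightarrow> 0"
proof -
  note [measurable_cong] = M
  have "(\<lambda>n :: nat. ennreal (norm w) * indicator {w. real n < norm w} w) \<longlonglongrightarrow> 0" for w :: 'a
  proof (rule tendsto_eventually)
    show "\<forall>\<^sub>F n in sequentially. ennreal (norm w) * indicator {w. real n < norm w} w = 0"
      using eventually_ge_at_top[of "nat \<lceil>norm w\<rceil>"]
      by eventually_elim (auto simp: indicator_def nat_le_iff ceiling_le_iff)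
  qed
  then have "(\<lambda>n :: nat. \<integral>\<^sup>+w. ennreal (norm w) * indicator {w. real n < norm w} w \<partial>M) \<longlonglongrightarrow> (\<integral>\<^sup>+w. 0 \<partial>M)"
    using fin by (intro nn_integral_dominated_convergence[where w = "\<lambda>w. ennreal (norm w)"])
      (auto simp: indicator_def)
  then show ?thesis by simp
qed

text \<open>The order of choices matters: the truncation level \<open>n\<close> is fixed first,
  uniformly in \<open>\<eta>\<close>, and only then \<open>\<eta>\<close> is moved towards
  \<open>\<theta>\<close>. Each of the two errors gets \<open>e / 4\<close> because the bound
  doubles their sum.\<close>

lemma tendsto_induced_map:
  fixes M :: "'a::{real_normed_vector, second_countable_topology} measure"
    and T :: "'a \<Rightarrow> 'a" and A :: "real \<Rightarrow> 'a set"
  assumes P: "prob_space M" and M: "sets M = sets borel" and fin: "(\<integral>\<^sup>+w. ennreal (norm w) \<partial>M) < \<infinity>"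
    and T: "measure_preserving M T"
    and A: "\<And>t. A t \<in> sets M" and mono: "mono A"
    and cont: "isCont (\<lambda>t. measure M (A t)) \<theta>"
  shows "((\<lambda>\<eta>. \<integral>\<^sup>+w. ennreal (norm (induced_map T (A \<eta>) w - induced_map T (A \<theta>) w)) \<partial>M) \<longlongrightarrow> 0) (at \<theta>)"
    (is "(?I \<longlongrightarrow> 0) _")
proof -
  interpret prob_space M by (rule P)
  show ?thesis
  proof (rule order_tendstoI)
    fix a :: ennreal assume "0 < a"
    define r where "r n = (\<integral>\<^sup>+w. ennreal (norm w) * indicator {w. real n < norm w} w \<partial>M)" for n
    obtain e where e: "0 < e" "ennreal e < a"
    proof (cases a)
      case (real x)
      then show ?thesis using \<open>0 < a\<close> by (intro that[of "x / 2"]) (simp_all add: ennreal_less_iff)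
    next
      case top
      then show ?thesis by (intro that[of 1]) simp_all
    qed
    have "r \<longlonglongrightarrow> 0" unfolding r_def by (rule nn_integral_norm_tail_tendsto_0[OF M fin])
    then have "\<forall>\<^sub>F n in sequentially. r n < ennreal (e / 4)"
      by (rule order_tendstoD(2)) (simp add: e(1))
    then obtain n where n: "r n < ennreal (e / 4)"
      using eventually_happens'[OF sequentially_bot] by blast
    have bound: "?I \<eta> \<le> 2 * (ennreal (real n * (2 * \<bar>prob (A \<eta>) - prob (A \<theta>)\<bar>)) + r n)" for \<eta>
    proof (cases "\<eta> \<le> \<theta>")
      case True
      then have sub: "A \<eta> \<subseteq> A \<theta>" by (rule monoD[OF mono])
      then have "prob (A \<eta>) \<le> prob (A \<theta>)" by (rule finite_measure_mono[OF _ A])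
      then show ?thesis
        using nn_integral_diff_induced_map_le[OF P M T A A sub, of "real n"] by (simp add: r_def)
    next
      case False
      then have "\<theta> \<le> \<eta>" by simp
      then have sub: "A \<theta> \<subseteq> A \<eta>" by (rule monoD[OF mono])
      then have "prob (A \<theta>) \<le> prob (A \<eta>)" by (rule finite_measure_mono[OF _ A])
      then show ?thesis
        using nn_integral_diff_induced_map_le[OF P M T A A sub, of "real n"]
        by (simp add: r_def norm_minus_commute)
    qed
    have "((\<lambda>\<eta>. real n * (2 * \<bar>prob (A \<eta>) - prob (A \<theta>)\<bar>)) \<longlongrightarrow> real n * (2 * \<bar>prob (A \<theta>) - prob (A \<theta>)\<bar>)) (at \<theta>)"
      by (intro tendsto_mult_left tendsto_rabs tendsto_diff tendsto_const cont[unfolded isCont_def])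
    then have "\<forall>\<^sub>F \<eta> in at \<theta>. real n * (2 * \<bar>prob (A \<eta>) - prob (A \<theta>)\<bar>) < e / 4"
      by (rule order_tendstoD(2)) (simp add: e(1))
    then show "\<forall>\<^sub>F \<eta> in at \<theta>. ?I \<eta> < a"
    proof eventually_elim
      case (elim \<eta>)
      have "?I \<eta> \<le> 2 * (ennreal (real n * (2 * \<bar>prob (A \<eta>) - prob (A \<theta>)\<bar>)) + r n)" by (rule bound)
      also have "\<dots> \<le> 2 * (ennreal (e / 4) + ennreal (e / 4))"
        using elim n by (intro mult_left_mono add_mono ennreal_leI) simp_all
      also have "\<dots> = ennreal e"
      proof -
        have double: "2 * ennreal x = ennreal (2 * x)" if "0 \<le> x" for x
          using that by (simp add: ennreal_mult)
        have "2 * (ennreal (e / 4) + ennreal (e / 4)) = 2 * (2 * ennreal (e / 4))"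
          by (simp only: mult_2)
        also have "\<dots> = ennreal (2 * (2 * (e / 4)))"
          using e(1) by (simp only: double divide_nonneg_pos mult_nonneg_nonneg less_imp_le zero_le_numeral)
        finally show ?thesis by simp
      qed
      finally show ?case using e(2) by simp
    qed
  qed simp
qed

section \<open>The path along the sublevel sets of a functional\<close>

theorem theorem6p1:
  fixes j :: "'h::{real_inner, banach, second_countable_topology} \<Rightarrow>
              'w::{banach, second_countable_topology}"
    and \<mu> :: "'w measure" and T :: "'w \<Rightarrow> 'w"
  assumes "abstract_wiener_space j \<mu>"
    and "measure_preserving \<mu> T"
    and "ae_invertible \<mu> T"
  shows "\<exists>T' :: real \<Rightarrow> 'w \<Rightarrow> 'w.
      (\<forall>\<theta>\<in>{0..1}. measure_preserving \<mu> (T' \<theta>)) \<and>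
      (AE w in \<mu>. T' 0 w = w) \<and>
      (AE w in \<mu>. T' 1 w = T w) \<and>
      (\<forall>\<theta>\<in>{0..1}.
        ((\<lambda>\<eta>. \<integral>\<^sup>+ w. ennreal (norm (T' \<eta> w - T' \<theta> w)) \<partial>\<mu>) \<longlongrightarrow> 0) (at \<theta> within {0..1}))"
proof -
  interpret abstract_wiener_space j \<mu> by fact
  note [measurable_cong] = sets_borel
  have sp: "space \<mu> = UNIV" using sets_eq_imp_space_eq[OF sets_borel] by simp
  show ?thesis
  \<comment> \<open>On the zero space there is no functional with a continuous law, but there
    \<open>T\<close> is the identity and the constant path works.\<close>
  proof (cases "\<exists>w0 :: 'w. w0 \<noteq> 0")
    case False
    then have "T w = w" for w by metis
    moreover have "measure_preserving \<mu> (\<lambda>w. w)" unfolding measure_preserving_def by simp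
    ultimately show ?thesis by (intro exI[of _ "\<lambda>_ w. w"]) simp
  next
    case True
    then obtain w0 :: 'w where "w0 \<noteq> 0" by blast
    obtain e :: "'w \<Rightarrow>\<^sub>L real" where "blinfun_apply e w0 = norm w0"
      by (rule norming_functional_exists[of w0])
    with \<open>w0 \<noteq> 0\<close> have "e \<noteq> 0" by auto
    \<comment> \<open>Values strictly inside the unit interval make \<open>A 0\<close> empty and
      \<open>A 1\<close> the whole space, so both endpoint conditions hold at every point.
      Injectivity of \<open>arctan\<close> keeps the law free of atoms.\<close>
    define g where "g w = arctan (blinfun_apply e w) / pi + 1 / 2" for w
    have [measurable]: "g \<in> borel_measurable \<mu>" unfolding g_def by measurable
    have g: "0 < g w" "g w < 1" for w
      using arctan_lbound[of "blinfun_apply e w"] arctan_ubound[of "blinfun_apply e w"]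
      unfolding g_def by (simp_all add: field_simps)
    define A where "A t = {w. g w \<le> t}" for t
    have A: "A t \<in> sets \<mu>" for t
      using measurable_sets[of g \<mu> borel "{..t}"] by (simp add: A_def sp vimage_def)
    interpret D: real_distribution "distr \<mu> borel g" by (rule real_distribution_distr) measurable
    have cdf: "cdf (distr \<mu> borel g) = (\<lambda>t. prob (A t))"
      unfolding cdf_def A_def by (subst measure_distr) (auto simp: sp vimage_def)
    have "measure (distr \<mu> borel g) {t} = 0" for t
    proof -
      have "measure (distr \<mu> borel g) {t} = prob {w. g w = t}"
        by (subst measure_distr) (auto simp: sp vimage_def)
      also have "\<dots> \<le> prob {w. blinfun_apply e w = tan ((t - 1 / 2) * pi)}"
      proof (rule finite_measure_mono)
        show "{w. g w = t} \<subseteq> {w. blinfun_apply e w = tan ((t - 1 / 2) * pi)}"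
        proof
          fix w assume "w \<in> {w. g w = t}"
          then have "(t - 1 / 2) * pi = arctan (blinfun_apply e w)" by (auto simp: g_def)
          then show "w \<in> {w. blinfun_apply e w = tan ((t - 1 / 2) * pi)}" by (simp only: tan_arctan mem_Collect_eq)
        qed
        show "{w. blinfun_apply e w = tan ((t - 1 / 2) * pi)} \<in> sets \<mu>"
          using measurable_sets[OF measurable_functional, of "{tan ((t - 1 / 2) * pi)}" e]
          by (simp add: sp vimage_def)
      qed
      also have "\<dots> = 0" by (rule functional_point_null[OF \<open>e \<noteq> 0\<close>])
      finally show ?thesis by (simp add: measure_le_0_iff)
    qed
    \<comment> \<open>Without atoms the distribution function of \<open>g\<close>, which is the
      measure of \<open>A t\<close>, is continuous.\<close>
    then have cont: "isCont (\<lambda>t. prob (A t)) t" for t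
      using D.isCont_cdf[of t] by (simp add: cdf)
    have mono: "mono A" by (auto simp: mono_def A_def)
    note lim = tendsto_induced_map[OF prob_space_axioms sets_borel nn_integral_norm_finite assms(2) A mono cont]
    have "A 0 = {}" "A 1 = UNIV"
      unfolding A_def using g(1) less_imp_le[OF g(2)] by (simp_all add: not_le[symmetric])
    then have ends: "induced_map T (A 0) w = w" "induced_map T (A 1) w = T w" for w
      by (simp_all only: induced_map_empty induced_map_UNIV)
    have lim_within: "((\<lambda>\<eta>. \<integral>\<^sup>+w. ennreal (norm (induced_map T (A \<eta>) w - induced_map T (A \<theta>) w)) \<partial>\<mu>)
        \<longlongrightarrow> 0) (at \<theta> within {0..1})" for \<theta>
      using lim by (rule tendsto_within_subset) simp
    show ?thesis
      by (intro exI[of _ "\<lambda>\<theta>. induced_map T (A \<theta>)"] conjI ballI AE_I2 ends lim_within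
          measure_preserving_induced_map[OF assms(2) A])
  qed
qed

end
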